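(* The symmetry group of Lamé's system of first order (written out in the context) is given by the following transformations: 1. translations in the independent variables: $\tilde x_i=x_i+v_i$; 2. dilations in the independent variables: $\tilde x_i=\lambda x_i$; 3. dilations in the dependent variables: $\tilde l_i=\rho\, l_i$; where $v_i\in\mathbb{R}$ and $\lambda,\rho\in\mathbb{R}\setminus\{0\}$. That is, each of these transformations is a symmetry, and the transformations obtained by exponentiating the infinitesimal generators of the symmetry group are compositions of these.
   Context: Subscripts $,x_i$ denote partial derivatives. Put $\varepsilon_1=\varepsilon_3=1$, $\varepsilon_2=-1$. The independent variables are $x=(x_1,x_2,x_3)$; the dependent variables are $l=(l_1,l_2,l_3)$ (nowhere zero) and $h=(h_{ij})_{i\neq j}$. Lamé's system of first order consists of the following equations for all distinct $i,j,k\in\{1,2,3\}$: $$\varepsilon_i l_i^2+\varepsilon_j l_j^2+\varepsilon_k l_k^2=0,\qquad l_{i,x_j}-h_{ij}l_j=0,\qquad \varepsilon_i l_{i,x_i}+\varepsilon_j h_{ji}l_j+\varepsilon_k h_{ki}l_k=0,$$ $$h_{ij,x_k}-h_{ik}h_{kj}=0,\qquad h_{ij,x_j}+h_{ji,x_i}+h_{ik}h_{jk}=0,\qquad \varepsilon_i h_{ij,x_i}+\varepsilon_j h_{ji,x_j}+\varepsilon_k h_{ki}h_{kj}=0.$$ The functions $h_{ij}=l_{i,x_j}/l_j$ are determined by $l$, so they transform accordingly: $h_{ij}$ is unchanged under translations in $x$ and dilations in $l$, and becomes $h_{ij}/\lambda$ under $\tilde x_i=\lambda x_i$. A symmetry is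 a point transformation of the space of variables $(x,l,h)$ carrying (graphs of) solutions of the system to solutions. "The symmetry group" is understood in Lie's sense, i.e. as the group obtained by exponentiating the Lie algebra of infinitesimal generators, these being the smooth vector fields $V$ on open sets of the space of variables $(x,l,h)$ (with coefficients considered at points satisfying $l_1^2-l_2^2+l_3^2=0$) whose first prolongation annihilates all the equations of the system whenever the equations of the system hold. (Discrete symmetries not arising in this way, such as permuting indices, are not considered.)
   Formalization: The exponential of a generator is shown to equal one composition on each connected set of points with l_1^2-l_2^2+l_3^2=0; on a disconnected open set different pieces may need different compositions (e.g. translate where l_1>0, fix where l_1<0). *)

theory Defs
  imports "HOL-Analysis.Analysis"
begin

section \<open>Smooth maps\<close>

text \<open>On an open set, being \<open>C\<^sup>k\<close> means that the first derivative exists and that each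
  of its directional values is \<open>C\<^sup>k\<^sup>-\<^sup>1\<close> (the domain is meant to be finite-dimensional).\<close>

fun Ck_on :: "nat \<Rightarrow> ('a::euclidean_space \<Rightarrow> 'b::real_normed_vector) \<Rightarrow> 'a set \<Rightarrow> bool" where
  "Ck_on 0 f S = continuous_on S f"
| "Ck_on (Suc k) f S =
     (\<exists>f'. (\<forall>x\<in>S. (f has_derivative f' x) (at x)) \<and> (\<forall>v. Ck_on k (\<lambda>x. f' x v) S))"

definition smooth_on_open :: "('a::euclidean_space \<Rightarrow> 'b::real_normed_vector) \<Rightarrow> 'a set \<Rightarrow> bool" where
  "smooth_on_open f S \<longleftrightarrow> open S \<and> (\<forall>k. Ck_on k f S)"

section \<open>The space of variables and its first jet space\<close>

text \<open>The index type of the family \<open>h\<close>: the six ordered pairs of distinct indices.\<close>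

typedef offdiag = "{(i :: 3, j :: 3). i \<noteq> j}"
  by (rule exI[of _ "(1, 2)"]) simp

instance offdiag :: finite
proof
  have "(UNIV :: offdiag set) = Abs_offdiag ` {(i, j). i \<noteq> j}"
    by (rule type_definition.Abs_image[OF type_definition_offdiag, symmetric])
  thus "finite (UNIV :: offdiag set)"
    by (metis finite finite_imageI)
qed

text \<open>Points \<open>(x, l, h)\<close>.\<close>

type_synonym pt = "(real^3) \<times> (real^3) \<times> (real^offdiag)"

text \<open>First jets \<open>(z, p, q)\<close>: at the point \<open>z\<close>, the derivative of \<open>l\<^sub>i\<close> with respect to
  \<open>x\<^sub>j\<close> is \<open>p $ i $ j\<close>, and that of \<open>h\<^sub>a\<close> with respect to \<open>x\<^sub>j\<close> is \<open>q $ a $ j\<close>.\<close>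

type_synonym jet = "pt \<times> (real^3^3) \<times> (real^3^offdiag)"

definition od :: "3 \<Rightarrow> 3 \<Rightarrow> offdiag" where
  "od i j = Abs_offdiag (i, j)"

definition eps :: "3 \<Rightarrow> real" where
  "eps i = (if i = 2 then - 1 else 1)"

definition variable_space :: "pt set" where
  "variable_space = {(x, l, h). \<forall>i. l $ i \<noteq> 0}"

text \<open>The points of the space of variables satisfying the algebraic equation of the system.\<close>

definition cone_points :: "pt set" where
  "cone_points = {(x, l, h) \<in> variable_space. (l$1)\<^sup>2 - (l$2)\<^sup>2 + (l$3)\<^sup>2 = 0}"

section \<open>Lame's system of first order\<close>

text \<open>The left-hand sides, as functions on the jet space.\<close>

definition lame_eqs_at :: "3 \<Rightarrow> 3 \<Rightarrow> 3 \<Rightarrow> (jet \<Rightarrow> real) set" where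
  "lame_eqs_at i j k =
    {\<lambda>((x, l, h), p, q). eps i * (l$i)\<^sup>2 + eps j * (l$j)\<^sup>2 + eps k * (l$k)\<^sup>2,
     \<lambda>((x, l, h), p, q). p$i$j - h$od i j * l$j,
     \<lambda>((x, l, h), p, q). eps i * p$i$i + eps j * h$od j i * l$j + eps k * h$od k i * l$k,
     \<lambda>((x, l, h), p, q). q$od i j$k - h$od i k * h$od k j,
     \<lambda>((x, l, h), p, q). q$od i j$j + q$od j i$i + h$od i k * h$od j k,
     \<lambda>((x, l, h), p, q). eps i * q$od i j$i + eps j * q$od j i$j + eps k * h$od k i * h$od k j}"

definition lame_eqs :: "(jet \<Rightarrow> real) set" where
  "lame_eqs = (\<Union>{lame_eqs_at i j k |i j k. i \<noteq> j \<and> j \<noteq> k \<and> i \<noteq> k})"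

definition lame_variety :: "jet set" where
  "lame_variety = {J. \<forall>F\<in>lame_eqs. F J = 0}"

definition partial :: "(real^3 \<Rightarrow> 'a::real_normed_vector) \<Rightarrow> 3 \<Rightarrow> real^3 \<Rightarrow> 'a" where
  "partial f j x = frechet_derivative f (at x) (axis j 1)"

definition jet_of :: "(real^3 \<Rightarrow> real^3) \<Rightarrow> (real^3 \<Rightarrow> real^offdiag) \<Rightarrow> real^3 \<Rightarrow> jet" where
  "jet_of l h x = ((x, l x, h x), (\<chi> i j. partial l j x $ i), (\<chi> a j. partial h j x $ a))"

definition lame_solution ::
  "(real^3) set \<Rightarrow> (real^3 \<Rightarrow> real^3) \<Rightarrow> (real^3 \<Rightarrow> real^offdiag) \<Rightarrow> bool" where
  "lame_solution D l h \<longleftrightarrow>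
     open D \<and> smooth_on_open l D \<and> smooth_on_open h D \<and>
     (\<forall>x\<in>D. (x, l x, h x) \<in> variable_space \<and> jet_of l h x \<in> lame_variety)"

section \<open>Symmetries\<close>

definition graph_of :: "(real^3) set \<Rightarrow> (real^3 \<Rightarrow> real^3) \<Rightarrow> (real^3 \<Rightarrow> real^offdiag) \<Rightarrow> pt set" where
  "graph_of D l h = (\<lambda>x. (x, l x, h x)) ` D"

definition point_transformation :: "(pt \<Rightarrow> pt) \<Rightarrow> bool" where
  "point_transformation g \<longleftrightarrow>
     bij_betw g variable_space variable_space \<and>
     smooth_on_open g variable_space \<and>
     smooth_on_open (inv_into variable_space g) variable_space"

definition lame_symmetry :: "(pt \<Rightarrow> pt) \<Rightarrow> bool" where
  "lame_symmetry g \<longleftrightarrow>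
     point_transformation g \<and>
     (\<forall>D l h. lame_solution D l h \<longrightarrow>
        (\<exists>D' l' h'. lame_solution D' l' h' \<and> g ` graph_of D l h = graph_of D' l' h'))"

definition translation :: "real^3 \<Rightarrow> pt \<Rightarrow> pt" where
  "translation v = (\<lambda>(x, l, h). (x + v, l, h))"

definition dilation_indep :: "real \<Rightarrow> pt \<Rightarrow> pt" where
  "dilation_indep c = (\<lambda>(x, l, h). (c *\<^sub>R x, l, h /\<^sub>R c))"

definition dilation_dep :: "real \<Rightarrow> pt \<Rightarrow> pt" where
  "dilation_dep r = (\<lambda>(x, l, h). (x, r *\<^sub>R l, h))"

definition basic_transformations :: "(pt \<Rightarrow> pt) set" where
  "basic_transformations =
     range translation \<union> dilation_indep ` (- {0}) \<union> dilation_dep ` (- {0})"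

inductive_set compositions :: "(pt \<Rightarrow> pt) set" where
  basic: "g \<in> basic_transformations \<Longrightarrow> g \<in> compositions"
| comp: "f \<in> compositions \<Longrightarrow> g \<in> compositions \<Longrightarrow> f \<circ> g \<in> compositions"

section \<open>Infinitesimal generators and their exponentials\<close>

text \<open>The total derivative with respect to \<open>x\<^sub>j\<close> of a function on the space of variables.\<close>

definition total_deriv :: "(pt \<Rightarrow> 'a::real_normed_vector) \<Rightarrow> 3 \<Rightarrow> jet \<Rightarrow> 'a" where
  "total_deriv f j = (\<lambda>(z, p, q).
     frechet_derivative f (at z) (axis j 1, (\<chi> i. p$i$j), (\<chi> a. q$a$j)))"

text \<open>The first prolongation of the vector field \<open>V = (\<xi>, \<eta>, \<phi>)\<close>, with components in the
  \<open>x\<close>-, \<open>l\<close>- and \<open>h\<close>-directions: the coefficient belonging to the derivative \<open>u\<^sub>j\<close> of a dependent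
  variable \<open>u\<close> is the total \<open>j\<close>-derivative of the \<open>u\<close>-component of \<open>V\<close>
  minus the sum over \<open>k\<close> of \<open>u\<^sub>k\<close> times the total \<open>j\<close>-derivative of \<open>\<xi>\<^sub>k\<close>.\<close>

definition prolong :: "(pt \<Rightarrow> pt) \<Rightarrow> jet \<Rightarrow> jet" where
  "prolong V = (\<lambda>(z, p, q).
     (let \<xi> = (\<lambda>z. fst (V z)); \<eta> = (\<lambda>z. fst (snd (V z))); \<phi> = (\<lambda>z. snd (snd (V z)));
          J = (z, p, q)
      in (V z,
          (\<chi> i j. total_deriv \<eta> j J $ i - (\<Sum>k\<in>UNIV. total_deriv \<xi> j J $ k * p$i$k)),
          (\<chi> a j. total_deriv \<phi> j J $ a - (\<Sum>k\<in>UNIV. total_deriv \<xi> j J $ k * q$a$k)))))"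

definition infinitesimal_generator :: "pt set \<Rightarrow> (pt \<Rightarrow> pt) \<Rightarrow> bool" where
  "infinitesimal_generator U V \<longleftrightarrow>
     U \<subseteq> variable_space \<and> smooth_on_open V U \<and>
     (\<forall>J\<in>lame_variety. fst J \<in> U \<longrightarrow>
        (\<forall>F\<in>lame_eqs. frechet_derivative F (at J) (prolong V J) = 0))"

text \<open>\<open>exp_field U V t z w\<close>: the exponential of \<open>t V\<close> is defined at \<open>z\<close> and maps \<open>z\<close> to \<open>w\<close>, i.e.
  the integral curve of \<open>V\<close> in \<open>U\<close> starting at \<open>z\<close> exists up to (possibly negative) time \<open>t\<close>, where
  it reaches \<open>w\<close>.\<close>

definition exp_field :: "pt set \<Rightarrow> (pt \<Rightarrow> pt) \<Rightarrow> real \<Rightarrow> pt \<Rightarrow> pt \<Rightarrow> bool" where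
  "exp_field U V t z w \<longleftrightarrow>
     (\<exists>c :: real \<Rightarrow> pt. c 0 = z \<and> c t = w \<and>
        (\<forall>s\<in>closed_segment 0 t.
           c s \<in> U \<and> (c has_vector_derivative V (c s)) (at s within closed_segment 0 t)))"

end

(* For the symmetries, all three families are covered by the maps (x, l, h) -> (c x + v, r l, h/c).

   For the generators, write V = (xi, eta, phi). Over a point of the cone the derivatives of l are
   determined, while those of h contain six free parameters. Since the linearised equations are
   polynomial in these parameters, xi and eta do not depend on h, and phi_ij depends on h_ij only.
   Derivatives of V tangent to the cone do not change along directions in which V is constant, so
   that the remaining equations may be compared at h and at h + s e_a. This forces xi_i to depend on
   x_i only, with a derivative c common to all i, and
     phi_ij = (b_ij - c) h_ij   with   b_ik + b_kj = b_ij,   b_ij = b_ji,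
   so b = 0, from which eta = r l with r locally constant. Hence on every connected piece of the cone
   V = (c x + v, r l, -c h). Its integral curves are explicit, they stay on the cone, and by uniqueness
   of solutions of ordinary differential equations they are the integral curves of V off the cone too. *)
theory Submission
  imports Defs
begin

section \<open>Similarities are symmetries\<close>

text \<open>V lives on an open set, but the equations are imposed only over the cone, so derivatives
  of V transversal to the cone are never controlled. Everything is therefore phrased through values
  of the derivative of V on tangent vectors. The directions \<open>jvec\<close> of the total
  derivatives are tangent, and so are the vectors into which they are split.

  The determining equations contain first derivatives of V. Comparing them at two values of h,
  rather than differentiating them in h, avoids second derivatives. A shift of a single h_nj changes
  only \<open>jvec j\<close>, by a multiple of one rotation of the l-space, so that few terms move
  in each comparison.

  The cocycle identity for b comes from the equation for the derivative of h_ij in the third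
  variable x_k, the symmetry from the equation for the diagonal derivative of l_i. Exchanging j and
  k in the cocycle identity and adding gives b_jk + b_kj = 0, whence b = 0 by symmetry. The equality
  of the derivatives of the xi_i comes from the equation that couples h_ij,x_j with h_ji,x_i, in
  which a free parameter is multiplied by both of them.\<close>

lemma Ck_on_const: "Ck_on k (\<lambda>x. c) S"
proof (induction k arbitrary: c)
  case (Suc k)
  show ?case
    by (auto intro!: exI[of _ "\<lambda>x v. 0"] Suc derivative_eq_intros)
qed simp

lemma Ck_on_affine:
  assumes "bounded_linear A" shows "Ck_on k (\<lambda>x. A x + b) S"
proof (cases k)
  case 0
  then show ?thesis
    using linear_continuous_on[OF assms] by (auto intro!: continuous_intros)
next
  case (Suc n)
  show ?thesis unfolding Suc Ck_on.simps
    by (rule exI[of _ "\<lambda>x. A"])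
      (auto intro!: Ck_on_const derivative_eq_intros bounded_linear_imp_has_derivative[OF assms])
qed

lemma Ck_on_cong:
  assumes "open S" "\<And>x. x \<in> S \<Longrightarrow> f x = g x" "Ck_on k f S"
  shows "Ck_on k g S"
proof (cases k)
  case 0
  then show ?thesis using assms continuous_on_cong by auto
next
  case (Suc n)
  then obtain f' where f': "\<And>x. x \<in> S \<Longrightarrow> (f has_derivative f' x) (at x)"
      "\<And>v. Ck_on n (\<lambda>x. f' x v) S"
    using assms(3) by auto
  have "(g has_derivative f' x) (at x)" if "x \<in> S" for x
    using has_derivative_transform_within_open[OF f'(1)[OF that] assms(1) that] assms(2) by auto
  with f'(2) show ?thesis unfolding Suc by auto
qed

text \<open>The factor \<open>a\<close> is carried along for the induction: each differentiation
  multiplies it by \<open>\<alpha>\<close>, while the directional values of the derivative take the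
  place of \<open>f\<close>.\<close>

lemma Ck_on_rescale:
  fixes f :: "'a::euclidean_space \<Rightarrow> 'b::real_normed_vector"
  assumes "Ck_on k f S"
  shows "Ck_on k (\<lambda>x. a *\<^sub>R f (\<alpha> *\<^sub>R x + \<beta>)) {x. \<alpha> *\<^sub>R x + \<beta> \<in> S}"
  using assms
proof (induction k arbitrary: f a)
  case 0
  then show ?case
    by (auto intro!: continuous_intros continuous_on_compose2[of S f])
next
  case (Suc k)
  then obtain f' where f': "\<And>x. x \<in> S \<Longrightarrow> (f has_derivative f' x) (at x)"
      "\<And>v. Ck_on k (\<lambda>x. f' x v) S"
    by auto
  let ?g = "\<lambda>x v. (a * \<alpha>) *\<^sub>R f' (\<alpha> *\<^sub>R x + \<beta>) v"
  have "((\<lambda>x. a *\<^sub>R f (\<alpha> *\<^sub>R x + \<beta>)) has_derivative ?g x) (at x)"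
    if "\<alpha> *\<^sub>R x + \<beta> \<in> S" for x
  proof -
    have "((\<lambda>x. \<alpha> *\<^sub>R x + \<beta>) has_derivative (\<lambda>v. \<alpha> *\<^sub>R v)) (at x)"
      by (auto intro!: derivative_eq_intros)
    from has_derivative_compose[OF this f'(1)[OF that]]
    have "((\<lambda>x. a *\<^sub>R f (\<alpha> *\<^sub>R x + \<beta>)) has_derivative
        (\<lambda>v. a *\<^sub>R f' (\<alpha> *\<^sub>R x + \<beta>) (\<alpha> *\<^sub>R v))) (at x)"
      by (rule has_derivative_scaleR_right)
    moreover have "linear (f' (\<alpha> *\<^sub>R x + \<beta>))"
      using f'(1)[OF that] has_derivative_linear by blast
    ultimately show ?thesis by (simp add: linear_scale)
  qed
  with Suc.IH[OF f'(2), of "a * \<alpha>"] show ?case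
    by (auto intro!: exI[of _ ?g])
qed

lemma smooth_on_open_differentiable:
  assumes "smooth_on_open f S" "x \<in> S"
  shows "(f has_derivative frechet_derivative f (at x)) (at x)"
proof -
  have "Ck_on (Suc 0) f S" using assms(1) by (auto simp only: smooth_on_open_def)
  then have "f differentiable (at x)" using assms(2) by (auto simp: differentiable_def)
  then show ?thesis by (simp add: frechet_derivative_works)
qed

definition similarity :: "real \<Rightarrow> real^3 \<Rightarrow> real \<Rightarrow> pt \<Rightarrow> pt" where
  "similarity c v r = (\<lambda>(x, l, h). (c *\<^sub>R x + v, r *\<^sub>R l, h /\<^sub>R c))"

lemma translation_eq_similarity: "translation v = similarity 1 v 1"
  and dilation_indep_eq_similarity: "dilation_indep c = similarity c 0 1"
  and dilation_dep_eq_similarity: "dilation_dep r = similarity 1 0 r"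
  by (auto simp: translation_def dilation_indep_def dilation_dep_def similarity_def)

lemma similarity_eq_comp:
  "similarity c v r = translation v \<circ> (dilation_indep c \<circ> dilation_dep r)"
  by (auto simp: translation_def dilation_indep_def dilation_dep_def similarity_def)

lemma similarity_in_compositions:
  assumes "c \<noteq> 0" "r \<noteq> 0" shows "similarity c v r \<in> compositions"
  unfolding similarity_eq_comp using assms
  by (intro compositions.intros) (auto simp: basic_transformations_def)

lemma similarity_inverse:
  assumes "c \<noteq> 0" "r \<noteq> 0"
  shows "similarity (1/c) (- (v /\<^sub>R c)) (1/r) (similarity c v r z) = z"
    and "similarity c v r (similarity (1/c) (- (v /\<^sub>R c)) (1/r) z) = z"
  using assms
  by (auto simp: similarity_def split_beta scaleR_add_right scaleR_diff_right divide_inverse prod_eq_iff)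

lemma similarity_variable_space:
  assumes "r \<noteq> 0" "z \<in> variable_space" shows "similarity c v r z \<in> variable_space"
  using assms by (auto simp: similarity_def variable_space_def)

lemma open_variable_space: "open variable_space"
proof -
  have "variable_space = (\<Inter>i. {z. fst (snd z) $ i \<noteq> 0})"
    by (auto simp: variable_space_def)
  moreover have "open {z :: pt. fst (snd z) $ i \<noteq> 0}" for i
    by (intro open_Collect_neq continuous_intros)
  ultimately show ?thesis by (metis (no_types, lifting) UNIV_I finite open_INT)
qed

lemma smooth_similarity: "smooth_on_open (similarity c v r) variable_space"
proof -
  define A :: "pt \<Rightarrow> pt" where "A = (\<lambda>z. (c *\<^sub>R fst z, r *\<^sub>R fst (snd z), snd (snd z) /\<^sub>R c))"
  have "bounded_linear A" unfolding A_def
    by (intro bounded_linear_Pair bounded_linear_scaleR_right[THEN bounded_linear_compose]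
        bounded_linear_fst bounded_linear_snd bounded_linear_fst_comp bounded_linear_snd_comp)
  moreover have "similarity c v r = (\<lambda>z. A z + (v, 0, 0))"
    by (auto simp: similarity_def A_def)
  ultimately show ?thesis
    using Ck_on_affine open_variable_space by (auto simp: smooth_on_open_def)
qed

lemma point_transformation_similarity:
  assumes "c \<noteq> 0" "r \<noteq> 0"
  shows "point_transformation (similarity c v r)"
proof -
  let ?g = "similarity c v r" and ?h = "similarity (1/c) (- (v /\<^sub>R c)) (1/r)"
  have bij: "bij_betw ?g variable_space variable_space"
    by (rule bij_betw_byWitness[of _ ?h])
      (use assms similarity_inverse similarity_variable_space in auto)
  have "inv_into variable_space ?g z = ?h z" if "z \<in> variable_space" for z
  proof (rule inv_into_f_eq)
    show "inj_on ?g variable_space" using bij by (rule bij_betw_imp_inj_on)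
  qed (use that assms similarity_inverse similarity_variable_space in auto)
  then have "smooth_on_open (inv_into variable_space ?g) variable_space"
    using smooth_similarity[of "1/c" "- (v /\<^sub>R c)" "1/r"]
    by (auto simp: smooth_on_open_def intro: Ck_on_cong[of _ "?h"])
  then show ?thesis
    using bij smooth_similarity by (auto simp: point_transformation_def)
qed

section \<open>Scaling covariance of the system and transport of solutions\<close>

lemma lame_variety_iff:
  "((x, l, h), p, q) \<in> lame_variety \<longleftrightarrow>
    (\<forall>i j k. i \<noteq> j \<and> j \<noteq> k \<and> i \<noteq> k \<longrightarrow>
      eps i * (l$i)\<^sup>2 + eps j * (l$j)\<^sup>2 + eps k * (l$k)\<^sup>2 = 0 \<and>
      p$i$j - h$od i j * l$j = 0 \<and>
      eps i * p$i$i + eps j * h$od j i * l$j + eps k * h$od k i * l$k = 0 \<and>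
      q$od i j$k - h$od i k * h$od k j = 0 \<and>
      q$od i j$j + q$od j i$i + h$od i k * h$od j k = 0 \<and>
      eps i * q$od i j$i + eps j * q$od j i$j + eps k * h$od k i * h$od k j = 0)"
proof -
  have *: "((x, l, h), p, q) \<in> lame_variety \<longleftrightarrow>
    (\<forall>i j k. i \<noteq> j \<and> j \<noteq> k \<and> i \<noteq> k \<longrightarrow> (\<forall>F\<in>lame_eqs_at i j k. F ((x, l, h), p, q) = 0))"
    unfolding lame_variety_def lame_eqs_def by blast
  show ?thesis unfolding * lame_eqs_at_def by simp
qed

text \<open>Every left-hand side is homogeneous: it is multiplied by r^2 (quadric), by r/c
  (equations for l) or by 1/c^2 (equations for h). The base point may become any \<open>x'\<close>
  because x does not occur in the system.\<close>

lemma lame_variety_rescale: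
  assumes J: "((x, l, h), p, q) \<in> lame_variety" and "c \<noteq> 0"
  shows "((x', r *\<^sub>R l, h /\<^sub>R c), (\<chi> i j. r / c * p$i$j), (\<chi> a j. q$a$j / c^2)) \<in> lame_variety"
  unfolding lame_variety_iff
proof (intro allI impI, elim conjE)
  fix i j k :: 3
  assume "i \<noteq> j" "j \<noteq> k" "i \<noteq> k"
  with J have e:
      "eps i * (l$i)\<^sup>2 + eps j * (l$j)\<^sup>2 + eps k * (l$k)\<^sup>2 = 0"
      "p$i$j - h$od i j * l$j = 0"
      "eps i * p$i$i + eps j * h$od j i * l$j + eps k * h$od k i * l$k = 0"
      "q$od i j$k - h$od i k * h$od k j = 0"
      "q$od i j$j + q$od j i$i + h$od i k * h$od j k = 0"
      "eps i * q$od i j$i + eps j * q$od j i$j + eps k * h$od k i * h$od k j = 0"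
    unfolding lame_variety_iff by blast+
  let ?l = "r *\<^sub>R l" and ?h = "h /\<^sub>R c" and ?p = "\<chi> i j. r / c * p$i$j"
    and ?q = "(\<chi> a j. q$a$j / c^2) :: real^3^offdiag"
  have "eps i * (?l$i)\<^sup>2 + eps j * (?l$j)\<^sup>2 + eps k * (?l$k)\<^sup>2
      = r\<^sup>2 * (eps i * (l$i)\<^sup>2 + eps j * (l$j)\<^sup>2 + eps k * (l$k)\<^sup>2)"
    by (simp add: algebra_simps power_mult_distrib)
  moreover have "?p$i$j - ?h$od i j * ?l$j = r / c * (p$i$j - h$od i j * l$j)"
    by (simp add: divide_inverse algebra_simps)
  moreover have "eps i * ?p$i$i + eps j * ?h$od j i * ?l$j + eps k * ?h$od k i * ?l$k
      = r / c * (eps i * p$i$i + eps j * h$od j i * l$j + eps k * h$od k i * l$k)"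
    by (simp add: divide_inverse algebra_simps)
  moreover have "?q$od i j$k - ?h$od i k * ?h$od k j = (q$od i j$k - h$od i k * h$od k j) / c\<^sup>2"
    by (simp add: divide_inverse algebra_simps power2_eq_square)
  moreover have "?q$od i j$j + ?q$od j i$i + ?h$od i k * ?h$od j k
      = (q$od i j$j + q$od j i$i + h$od i k * h$od j k) / c\<^sup>2"
    by (simp add: divide_inverse algebra_simps power2_eq_square)
  moreover have "eps i * ?q$od i j$i + eps j * ?q$od j i$j + eps k * ?h$od k i * ?h$od k j
      = (eps i * q$od i j$i + eps j * q$od j i$j + eps k * h$od k i * h$od k j) / c\<^sup>2"
    by (simp add: divide_inverse algebra_simps power2_eq_square)
  ultimately show
      "eps i * (?l$i)\<^sup>2 + eps j * (?l$j)\<^sup>2 + eps k * (?l$k)\<^sup>2 = 0 \<and>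
      ?p$i$j - ?h$od i j * ?l$j = 0 \<and>
      eps i * ?p$i$i + eps j * ?h$od j i * ?l$j + eps k * ?h$od k i * ?l$k = 0 \<and>
      ?q$od i j$k - ?h$od i k * ?h$od k j = 0 \<and>
      ?q$od i j$j + ?q$od j i$i + ?h$od i k * ?h$od j k = 0 \<and>
      eps i * ?q$od i j$i + eps j * ?q$od j i$j + eps k * ?h$od k i * ?h$od k j = 0"
    unfolding e by simp
qed

lemma partial_rescale:
  fixes f :: "real^3 \<Rightarrow> 'a::real_normed_vector"
  assumes "(f has_derivative f') (at (\<alpha> *\<^sub>R y + \<beta>))"
  shows "partial (\<lambda>x. a *\<^sub>R f (\<alpha> *\<^sub>R x + \<beta>)) j y = (a * \<alpha>) *\<^sub>R partial f j (\<alpha> *\<^sub>R y + \<beta>)"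
proof -
  have "((\<lambda>x. \<alpha> *\<^sub>R x + \<beta>) has_derivative (\<lambda>v. \<alpha> *\<^sub>R v)) (at y)"
    by (auto intro!: derivative_eq_intros)
  from has_derivative_compose[OF this assms]
  have "((\<lambda>x. a *\<^sub>R f (\<alpha> *\<^sub>R x + \<beta>)) has_derivative (\<lambda>v. a *\<^sub>R f' (\<alpha> *\<^sub>R v))) (at y)"
    by (rule has_derivative_scaleR_right)
  moreover have "linear f'" using assms has_derivative_linear by blast
  ultimately show ?thesis
    by (simp add: partial_def frechet_derivative_at[symmetric] linear_scale
        frechet_derivative_at[OF assms, symmetric])
qed

lemma lame_symmetry_similarity:
  assumes c: "c \<noteq> 0" and r: "r \<noteq> 0"
  shows "lame_symmetry (similarity c v r)"
  unfolding lame_symmetry_def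
proof (intro conjI allI impI)
  fix D l h assume sol: "lame_solution D l h"
  define \<beta> where "\<beta> = - (v /\<^sub>R c)"
  \<comment> \<open>\<open>A\<close> inverts x -> c x + v, so the image of the graph is the graph
    over \<open>D'\<close> of the functions \<open>l'\<close> and \<open>h'\<close> defined
    next.\<close>
  define A where "A y = inverse c *\<^sub>R y + \<beta>" for y :: "real^3"
  define D' where "D' = {y. A y \<in> D}"
  define l' where "l' = (\<lambda>y. r *\<^sub>R l (A y))"
  define h' where "h' = (\<lambda>y. inverse c *\<^sub>R h (A y))"
  have AI: "A (c *\<^sub>R x + v) = x" and IA: "c *\<^sub>R A x + v = x" for x
    using c by (simp_all add: A_def \<beta>_def scaleR_add_right scaleR_diff_right)
  have D: "open D" "smooth_on_open l D" "smooth_on_open h D" using sol by (auto simp: lame_solution_def)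
  have oD': "open D'" unfolding D'_def A_def
    using open_vimage[OF D(1), of "\<lambda>y. inverse c *\<^sub>R y + \<beta>"]
    by (simp add: vimage_def continuous_intros)
  have sm: "smooth_on_open l' D'" "smooth_on_open h' D'"
    using D oD' Ck_on_rescale[of _ l D r "inverse c" \<beta>] Ck_on_rescale[of _ h D "inverse c" "inverse c" \<beta>]
    by (auto simp: smooth_on_open_def l'_def h'_def D'_def A_def)
  have "jet_of l' h' y \<in> lame_variety" "(y, l' y, h' y) \<in> variable_space" if "y \<in> D'" for y
  proof -
    have yD: "A y \<in> D" using that by (simp add: D'_def)
    then have J: "jet_of l h (A y) \<in> lame_variety" and v: "(A y, l (A y), h (A y)) \<in> variable_space"
      using sol by (auto simp: lame_solution_def)
    show "(y, l' y, h' y) \<in> variable_space" using v r by (auto simp: variable_space_def l'_def)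
    have pl: "partial l' j y = (r * inverse c) *\<^sub>R partial l j (A y)" for j
      unfolding l'_def A_def
      by (rule partial_rescale, rule smooth_on_open_differentiable[OF D(2)]) (use yD A_def in auto)
    have ph: "partial h' j y = (inverse c * inverse c) *\<^sub>R partial h j (A y)" for j
      unfolding h'_def A_def
      by (rule partial_rescale, rule smooth_on_open_differentiable[OF D(3)]) (use yD A_def in auto)
    have "jet_of l' h' y = ((y, r *\<^sub>R l (A y), h (A y) /\<^sub>R c),
        (\<chi> i j. r / c * (\<chi> i j. partial l j (A y) $ i) $ i $ j),
        (\<chi> a j. (\<chi> a j. partial h j (A y) $ a) $ a $ j / c^2))"
      unfolding jet_of_def pl ph
      by (simp add: l'_def h'_def vec_eq_iff divide_inverse power2_eq_square)
    then show "jet_of l' h' y \<in> lame_variety"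
      using lame_variety_rescale[OF J[unfolded jet_of_def] c] by simp
  qed
  then have "lame_solution D' l' h'" using oD' sm by (auto simp: lame_solution_def)
  moreover have "similarity c v r ` graph_of D l h = graph_of D' l' h'"
  proof
    show "similarity c v r ` graph_of D l h \<subseteq> graph_of D' l' h'"
      by (auto simp: graph_of_def similarity_def D'_def l'_def h'_def AI intro!: image_eqI)
    show "graph_of D' l' h' \<subseteq> similarity c v r ` graph_of D l h"
    proof
      fix z assume "z \<in> graph_of D' l' h'"
      then obtain y where "A y \<in> D" "z = (y, l' y, h' y)" by (auto simp: graph_of_def D'_def)
      then show "z \<in> similarity c v r ` graph_of D l h"
        by (intro image_eqI[of _ _ "(A y, l (A y), h (A y))"])
          (auto simp: graph_of_def similarity_def l'_def h'_def IA)
    qed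
  qed
  ultimately show "\<exists>D' l' h'. lame_solution D' l' h' \<and>
      similarity c v r ` graph_of D l h = graph_of D' l' h'" by blast
qed (rule point_transformation_similarity[OF c r])

section \<open>The determining equations\<close>

text \<open>Computations use an arbitrary triple of distinct indices instead of numerals, so that
  one argument serves all permutations.\<close>

lemma distinct3_UNIV:
  fixes i j k :: 3
  assumes "i \<noteq> j" "j \<noteq> k" "i \<noteq> k"
  shows "UNIV = {i, j, k}"
  by (rule card_seteq[symmetric]) (use assms in auto)

lemma sum_distinct3:
  fixes i j k :: 3 and f :: "3 \<Rightarrow> 'a::comm_monoid_add"
  assumes "i \<noteq> j" "j \<noteq> k" "i \<noteq> k"
  shows "sum f UNIV = f i + (f j + f k)"
  unfolding distinct3_UNIV[OF assms] using assms by simp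

lemma obtain_third:
  fixes i j :: 3
  assumes "i \<noteq> j"
  obtains k where "j \<noteq> k" "i \<noteq> k"
proof -
  have "card {i, j} \<noteq> CARD(3)" using assms by simp
  then have "{i, j} \<noteq> UNIV" by metis
  then obtain k where "k \<notin> {i, j}" by blast
  then show thesis by (intro that[of k]) auto
qed

lemma od_eq_iff: "i \<noteq> j \<Longrightarrow> m \<noteq> n \<Longrightarrow> od i j = od m n \<longleftrightarrow> i = m \<and> j = n"
  by (simp add: od_def Abs_offdiag_inject)

lemma offdiag_cases:
  obtains i j where "a = od i j" "i \<noteq> j"
  by (cases a) (auto simp: od_def)

section \<open>Linearised left-hand sides; \<open>dx\<close> does not enter since x does not occur
  in the system\<close>

lemma frechet_lame_l_offdiag:
  "frechet_derivative (\<lambda>((x, l, h), p, q). p$i$j - h$od i j * l$j)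
     (at (((x, l, h), p, q) :: jet)) ((dx, dl, dh), dp, dq) =
   dp$i$j - (dh$od i j * l$j + h$od i j * dl$j)"
proof -
  note [derivative_intros] = bounded_linear.has_derivative[OF bounded_linear_vec_nth]
  have "((\<lambda>((x, l, h), p, q). p$i$j - h$od i j * l$j) has_derivative
    (\<lambda>((dx, dl, dh), dp, dq). dp$i$j - (dh$od i j * l$j + h$od i j * dl$j)))
    (at (((x, l, h), p, q) :: jet))"
    unfolding case_prod_beta'
    by (auto intro!: derivative_eq_intros simp: algebra_simps)
  then show ?thesis by (simp add: frechet_derivative_at[symmetric])
qed

lemma frechet_lame_l_diag:
  "frechet_derivative (\<lambda>((x, l, h), p, q). eps i * p$i$i + eps j * h$od j i * l$j + eps k * h$od k i * l$k)
     (at (((x, l, h), p, q) :: jet)) ((dx, dl, dh), dp, dq) =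
   eps i * dp$i$i + eps j * (dh$od j i * l$j + h$od j i * dl$j) + eps k * (dh$od k i * l$k + h$od k i * dl$k)"
proof -
  note [derivative_intros] = bounded_linear.has_derivative[OF bounded_linear_vec_nth]
  have "((\<lambda>((x, l, h), p, q). eps i * p$i$i + eps j * h$od j i * l$j + eps k * h$od k i * l$k) has_derivative
    (\<lambda>((dx, dl, dh), dp, dq). eps i * dp$i$i + eps j * (dh$od j i * l$j + h$od j i * dl$j)
        + eps k * (dh$od k i * l$k + h$od k i * dl$k)))
    (at (((x, l, h), p, q) :: jet))"
    unfolding case_prod_beta'
    by (auto intro!: derivative_eq_intros simp: algebra_simps)
  then show ?thesis by (simp add: frechet_derivative_at[symmetric])
qed

lemma frechet_lame_h_third:
  "frechet_derivative (\<lambda>((x, l, h), p, q). q$od i j$k - h$od i k * h$od k j)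
     (at (((x, l, h), p, q) :: jet)) ((dx, dl, dh), dp, dq) =
   dq$od i j$k - (dh$od i k * h$od k j + h$od i k * dh$od k j)"
proof -
  note [derivative_intros] = bounded_linear.has_derivative[OF bounded_linear_vec_nth]
  have "((\<lambda>((x, l, h), p, q). q$od i j$k - h$od i k * h$od k j) has_derivative
    (\<lambda>((dx, dl, dh), dp, dq). dq$od i j$k - (dh$od i k * h$od k j + h$od i k * dh$od k j)))
    (at (((x, l, h), p, q) :: jet))"
    unfolding case_prod_beta'
    by (auto intro!: derivative_eq_intros simp: algebra_simps)
  then show ?thesis by (simp add: frechet_derivative_at[symmetric])
qed

lemma frechet_lame_h_skew:
  "frechet_derivative (\<lambda>((x, l, h), p, q). q$od i j$j + q$od j i$i + h$od i k * h$od j k)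
     (at (((x, l, h), p, q) :: jet)) ((dx, dl, dh), dp, dq) =
   dq$od i j$j + dq$od j i$i + (dh$od i k * h$od j k + h$od i k * dh$od j k)"
proof -
  note [derivative_intros] = bounded_linear.has_derivative[OF bounded_linear_vec_nth]
  have "((\<lambda>((x, l, h), p, q). q$od i j$j + q$od j i$i + h$od i k * h$od j k) has_derivative
    (\<lambda>((dx, dl, dh), dp, dq). dq$od i j$j + dq$od j i$i + (dh$od i k * h$od j k + h$od i k * dh$od j k)))
    (at (((x, l, h), p, q) :: jet))"
    unfolding case_prod_beta'
    by (auto intro!: derivative_eq_intros simp: algebra_simps)
  then show ?thesis by (simp add: frechet_derivative_at[symmetric])
qed

text \<open>The \<open>j\<close>-th column of derivatives of \<open>l\<close>, and the columns of derivatives of \<open>h\<close>, of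
  the jets in the variety over a point \<open>(x, l, h)\<close> of the cone.\<close>

definition pcol :: "real^3 \<Rightarrow> real^offdiag \<Rightarrow> 3 \<Rightarrow> real^3" where
  "pcol l h j = (\<chi> i. if i \<noteq> j then h$od i j * l$j
     else - eps j * (\<Sum>n\<in>UNIV - {j}. eps n * h$od n j * l$n))"

definition admissible :: "real^offdiag \<Rightarrow> (3 \<Rightarrow> real^offdiag) \<Rightarrow> bool" where
  "admissible h Q \<longleftrightarrow> (\<forall>i j k. i \<noteq> j \<and> j \<noteq> k \<and> i \<noteq> k \<longrightarrow>
     Q k$od i j = h$od i k * h$od k j \<and>
     Q j$od i j + Q i$od j i + h$od i k * h$od j k = 0 \<and>
     eps i * Q i$od i j + eps j * Q j$od j i + eps k * h$od k i * h$od k j = 0)"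

lemma eps_sq [simp]: "eps i * eps i = 1" "eps i * (eps i * t) = t"
  by (auto simp: eps_def)

lemma eps_nonzero [simp]: "eps i \<noteq> 0" by (auto simp: eps_def)

lemma pcol_offdiag: "i \<noteq> j \<Longrightarrow> pcol l h j $ i = h$od i j * l$j"
  by (simp add: pcol_def)

lemma pcol_diag:
  assumes "i \<noteq> j" "j \<noteq> k" "i \<noteq> k"
  shows "pcol l h i $ i = - eps i * (eps j * h$od j i * l$j + eps k * h$od k i * l$k)"
proof -
  have "UNIV - {i} = {j, k}" using distinct3_UNIV[OF assms] assms by auto
  then show ?thesis using assms by (simp add: pcol_def)
qed

lemma cone_iff:
  assumes "i \<noteq> j" "j \<noteq> k" "i \<noteq> k"
  shows "(x, l, h) \<in> cone_points \<longleftrightarrow>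
    (\<forall>n. l$n \<noteq> 0) \<and> eps i * (l$i)\<^sup>2 + eps j * (l$j)\<^sup>2 + eps k * (l$k)\<^sup>2 = 0"
proof -
  have "(l$1)\<^sup>2 - (l$2)\<^sup>2 + (l$3)\<^sup>2 = (\<Sum>n\<in>UNIV. eps n * (l$n)\<^sup>2)"
    by (simp add: sum_3 eps_def)
  then show ?thesis
    unfolding sum_distinct3[OF assms] by (auto simp: cone_points_def variable_space_def)
qed

text \<open>Over a point of the cone the equations decouple: those for l are solved by
  \<open>pcol\<close>, the others constrain \<open>Q\<close> alone. Hence \<open>Q\<close> can be
  varied while the point and the derivatives of l stay fixed.\<close>

lemma jet_in_variety:
  assumes "(x, l, h) \<in> cone_points" "admissible h Q"
  shows "((x, l, h), (\<chi> i j. pcol l h j $ i), (\<chi> a j. Q j $ a)) \<in> lame_variety"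
  unfolding lame_variety_iff
proof (intro allI impI)
  fix i j k :: 3 assume "i \<noteq> j \<and> j \<noteq> k \<and> i \<noteq> k"
  then have d: "i \<noteq> j" "j \<noteq> k" "i \<noteq> k" by auto
  show "eps i * (l$i)\<^sup>2 + eps j * (l$j)\<^sup>2 + eps k * (l$k)\<^sup>2 = 0 \<and>
      (\<chi> i j. pcol l h j $ i)$i$j - h$od i j * l$j = 0 \<and>
      eps i * (\<chi> i j. pcol l h j $ i)$i$i + eps j * h$od j i * l$j + eps k * h$od k i * l$k = 0 \<and>
      (\<chi> a j. Q j $ a)$od i j$k - h$od i k * h$od k j = 0 \<and>
      (\<chi> a j. Q j $ a)$od i j$j + (\<chi> a j. Q j $ a)$od j i$i + h$od i k * h$od j k = 0 \<and>
      eps i * (\<chi> a j. Q j $ a)$od i j$i + eps j * (\<chi> a j. Q j $ a)$od j i$j + eps k * h$od k i * h$od k j = 0"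
    using assms(1)[unfolded cone_iff[OF d]] assms(2)[unfolded admissible_def] d
    by (simp add: pcol_offdiag pcol_diag[OF d])
qed

lemma admissible_exists: "\<exists>Q. admissible h Q"
proof -
  define third where "third i j = (THE k. k \<noteq> i \<and> k \<noteq> j)" for i j :: 3
  have third: "third i j = k" if "i \<noteq> j" "j \<noteq> k" "i \<noteq> k" for i j k
    unfolding third_def by (rule the_equality) (use that distinct3_UNIV[OF that] in auto)
  \<comment> \<open>The derivative in the third variable is forced. For each unordered pair of
    indices the two remaining equations fix one sum and one weighted sum of two derivatives; each
    summand receives half.\<close>
  define Q :: "3 \<Rightarrow> real^offdiag" where "Q m = (\<chi> a. let i = fst (Rep_offdiag a); j = snd (Rep_offdiag a); k = third i j in
     if m = j then - (h$od i k * h$od j k) / 2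
     else if m = i then - eps i * (eps k * h$od k i * h$od k j) / 2
     else h$od i k * h$od k j)" for m
  have Rep: "Rep_offdiag (od i j) = (i, j)" if "i \<noteq> j" for i j
    using that by (simp add: od_def Abs_offdiag_inverse)
  have "admissible h Q" unfolding admissible_def
  proof (intro allI impI)
    fix i j k :: 3 assume "i \<noteq> j \<and> j \<noteq> k \<and> i \<noteq> k"
    then have d: "i \<noteq> j" "j \<noteq> k" "i \<noteq> k" "j \<noteq> i" "k \<noteq> j" "k \<noteq> i" by auto
    have t: "third i j = k" "third j i = k" using third d by auto
    show "Q k$od i j = h$od i k * h$od k j \<and>
     Q j$od i j + Q i$od j i + h$od i k * h$od j k = 0 \<and>
     eps i * Q i$od i j + eps j * Q j$od j i + eps k * h$od k i * h$od k j = 0"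
      using d by (simp add: Q_def Rep t Let_def)
  qed
  then show ?thesis by blast
qed

text \<open>The two perturbations per unordered pair of indices account for the six free parameters.\<close>

lemma admissible_perturb1:
  assumes Q: "admissible h Q" and km: "k \<noteq> m"
  shows "admissible h (Q(k := Q k + s *\<^sub>R axis (od m k) 1, m := Q m - s *\<^sub>R axis (od k m) 1))"
  unfolding admissible_def
proof (intro allI impI)
  fix i j n :: 3 assume "i \<noteq> j \<and> j \<noteq> n \<and> i \<noteq> n"
  then have d: "i \<noteq> j" "j \<noteq> n" "i \<noteq> n" "j \<noteq> i" "n \<noteq> j" "n \<noteq> i" by auto
  let ?Q = "Q(k := Q k + s *\<^sub>R axis (od m k) 1, m := Q m - s *\<^sub>R axis (od k m) 1)"
  have A: "?Q c $ od a b = Q c $ od a b + (if b = c \<and> a = m \<and> b = k then s else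
     if b = c \<and> a = k \<and> b = m then - s else 0)" if "a \<noteq> b" for a b c
    using that km by (auto simp: axis_def od_eq_iff)
  have e: "Q n$od i j = h$od i n * h$od n j"
     "Q j$od i j + Q i$od j i + h$od i n * h$od j n = 0"
     "eps i * Q i$od i j + eps j * Q j$od j i + eps n * h$od n i * h$od n j = 0"
    using Q d unfolding admissible_def by blast+
  show "?Q n$od i j = h$od i n * h$od n j \<and>
     ?Q j$od i j + ?Q i$od j i + h$od i n * h$od j n = 0 \<and>
     eps i * ?Q i$od i j + eps j * ?Q j$od j i + eps n * h$od n i * h$od n j = 0"
    unfolding A[OF d(1)] A[OF d(4)] using d e km by auto
qed

text \<open>The derivatives of h_km in x_k and of h_mk in x_m meet only in the equation weighted by
  \<open>eps\<close>, so a change of one is balanced by \<open>eps k * eps m\<close> times the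
  other. In \<open>admissible_perturb1\<close> the balanced pair is h_mk in x_k and h_km in
  x_m.\<close>

lemma admissible_perturb2:
  assumes Q: "admissible h Q" and km: "k \<noteq> m"
  shows "admissible h (Q(k := Q k + s *\<^sub>R axis (od k m) 1,
     m := Q m - (s * eps k * eps m) *\<^sub>R axis (od m k) 1))"
  unfolding admissible_def
proof (intro allI impI)
  fix i j n :: 3 assume "i \<noteq> j \<and> j \<noteq> n \<and> i \<noteq> n"
  then have d: "i \<noteq> j" "j \<noteq> n" "i \<noteq> n" "j \<noteq> i" "n \<noteq> j" "n \<noteq> i" by auto
  let ?Q = "Q(k := Q k + s *\<^sub>R axis (od k m) 1, m := Q m - (s * eps k * eps m) *\<^sub>R axis (od m k) 1)"
  have A: "?Q c $ od a b = Q c $ od a b + (if a = c \<and> a = k \<and> b = m then s else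
     if a = c \<and> a = m \<and> b = k then - (s * eps k * eps m) else 0)" if "a \<noteq> b" for a b c
    using that km by (auto simp: axis_def od_eq_iff)
  have e: "Q n$od i j = h$od i n * h$od n j"
     "Q j$od i j + Q i$od j i + h$od i n * h$od j n = 0"
     "eps i * Q i$od i j + eps j * Q j$od j i + eps n * h$od n i * h$od n j = 0"
    using Q d unfolding admissible_def by blast+
  show "?Q n$od i j = h$od i n * h$od n j \<and>
     ?Q j$od i j + ?Q i$od j i + h$od i n * h$od j n = 0 \<and>
     eps i * ?Q i$od i j + eps j * ?Q j$od j i + eps n * h$od n i * h$od n j = 0"
    unfolding A[OF d(1)] A[OF d(4)] using d e km by (auto simp: algebra_simps)
qed

text \<open>The direction along which the total \<open>j\<close>-derivative is taken.\<close>

definition jvec :: "3 \<Rightarrow> real^3 \<Rightarrow> real^offdiag \<Rightarrow> real^offdiag \<Rightarrow> pt" where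
  "jvec j l h w = (axis j 1, pcol l h j, w)"

section \<open>Components of a generator and the equations they satisfy\<close>

locale lame_generator =
  fixes U :: "pt set" and V :: "pt \<Rightarrow> pt"
  assumes gen: "infinitesimal_generator U V"
begin

abbreviation "DV z \<equiv> frechet_derivative V (at z)"

definition xi where "xi i z = fst (V z) $ i"
definition eta where "eta i z = fst (snd (V z)) $ i"
definition phi where "phi i j z = snd (snd (V z)) $ od i j"
definition dxi where "dxi i z u = fst (DV z u) $ i"
definition deta where "deta i z u = fst (snd (DV z u)) $ i"
definition dphi where "dphi i j z u = snd (snd (DV z u)) $ od i j"

lemma open_U: "open U" using gen by (simp add: infinitesimal_generator_def smooth_on_open_def)

lemma DV: "z \<in> U \<Longrightarrow> (V has_derivative DV z) (at z)"
  using gen smooth_on_open_differentiable by (auto simp: infinitesimal_generator_def)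

lemma
  assumes "z \<in> U"
  shows has_derivative_xi: "(xi i has_derivative dxi i z) (at z)"
    and has_derivative_eta: "(eta i has_derivative deta i z) (at z)"
    and has_derivative_phi: "(phi i j has_derivative dphi i j z) (at z)"
  unfolding xi_def[abs_def] eta_def[abs_def] phi_def[abs_def]
    dxi_def[abs_def] deta_def[abs_def] dphi_def[abs_def]
  by (intro bounded_linear.has_derivative[OF bounded_linear_vec_nth]
      has_derivative_fst has_derivative_snd DV[OF assms])+

text \<open>The generator condition at the jets supplied by \<open>jet_in_variety\<close>.
  \<open>Q\<close> is kept arbitrary, so that the equations for two choices of it can be
  subtracted.\<close>

lemma determining:
  assumes z: "(x, l, h) \<in> U" "(x, l, h) \<in> cone_points" and Q: "admissible h Q"
    and d: "i \<noteq> j" "j \<noteq> k" "i \<noteq> k"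
  defines "z \<equiv> (x, l, h)" and "w \<equiv> (\<lambda>j. jvec j l h (Q j))"
  shows "deta i z (w j) - (\<Sum>m\<in>UNIV. dxi m z (w j) * pcol l h m $ i)
      = phi i j z * l$j + h$od i j * eta j z"
    and "eps i * (deta i z (w i) - (\<Sum>m\<in>UNIV. dxi m z (w i) * pcol l h m $ i))
      + eps j * (phi j i z * l$j + h$od j i * eta j z)
      + eps k * (phi k i z * l$k + h$od k i * eta k z) = 0"
    and "dphi i j z (w k) - (\<Sum>m\<in>UNIV. dxi m z (w k) * Q m $ od i j)
      = phi i k z * h$od k j + h$od i k * phi k j z"
    and "dphi i j z (w j) - (\<Sum>m\<in>UNIV. dxi m z (w j) * Q m $ od i j)
      + (dphi j i z (w i) - (\<Sum>m\<in>UNIV. dxi m z (w i) * Q m $ od j i))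
      + (phi i k z * h$od j k + h$od i k * phi j k z) = 0"
proof -
  define J where "J = (z, (\<chi> i j. pcol l h j $ i) :: real^3^3, (\<chi> a j. Q j $ a) :: real^3^offdiag)"
  have J: "J \<in> lame_variety" unfolding J_def z_def by (rule jet_in_variety[OF z(2) Q])
  have all: "frechet_derivative F (at J) (prolong V J) = 0" if "F \<in> lame_eqs_at i j k" for F
  proof -
    have "F \<in> lame_eqs" using that d unfolding lame_eqs_def by blast
    moreover have "fst J \<in> U" using z(1) by (simp add: J_def z_def)
    ultimately show ?thesis using gen J unfolding infinitesimal_generator_def by blast
  qed
  \<comment> \<open>The vector along which \<open>total_deriv\<close> differentiates at this jet is
    \<open>jvec\<close> for the j-th columns.\<close>
  have w: "(axis j 1, (\<chi> i. (\<chi> i j. pcol l h j $ i) $ i $ j), (\<chi> a. (\<chi> a j. Q j $ a) $ a $ j)) = w j" for j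
    by (simp add: w_def jvec_def vec_eq_iff)
  have zU: "z \<in> U" using z by (simp add: z_def)
  have fd: "frechet_derivative (\<lambda>z. fst (V z)) (at z) = (\<lambda>u. fst (DV z u))"
     "frechet_derivative (\<lambda>z. fst (snd (V z))) (at z) = (\<lambda>u. fst (snd (DV z u)))"
     "frechet_derivative (\<lambda>z. snd (snd (V z))) (at z) = (\<lambda>u. snd (snd (DV z u)))"
    by (rule frechet_derivative_at[symmetric],
        intro has_derivative_fst has_derivative_snd DV[OF zU])+
  define dp :: "real^3^3" where "dp = (\<chi> i j. deta i z (w j) - (\<Sum>m\<in>UNIV. dxi m z (w j) * pcol l h m $ i))"
  define dq :: "real^3^offdiag" where "dq = (\<chi> a j. snd (snd (DV z (w j))) $ a - (\<Sum>m\<in>UNIV. dxi m z (w j) * Q m $ a))"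
  have pr: "prolong V J = ((fst (V z), fst (snd (V z)), snd (snd (V z))), dp, dq)"
    unfolding prolong_def J_def prod.case Let_def total_deriv_def fd w
    by (simp add: dp_def dq_def dxi_def deta_def vec_eq_iff)
  have Jx: "J = ((x, l, h), (\<chi> i j. pcol l h j $ i), (\<chi> a j. Q j $ a))" by (simp add: J_def z_def)
  note all' = all[unfolded lame_eqs_at_def, unfolded pr, unfolded Jx]
  have "dp$i$j - (phi i j z * l$j + h$od i j * eta j z) = 0"
    using all'[of "\<lambda>((x, l, h), p, q). p$i$j - h$od i j * l$j"]
    unfolding frechet_lame_l_offdiag by (simp add: phi_def eta_def)
  then show "deta i z (w j) - (\<Sum>m\<in>UNIV. dxi m z (w j) * pcol l h m $ i)
      = phi i j z * l$j + h$od i j * eta j z" by (simp add: dp_def)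
  have "eps i * dp$i$i + eps j * (phi j i z * l$j + h$od j i * eta j z) + eps k * (phi k i z * l$k + h$od k i * eta k z) = 0"
    using all'[of "\<lambda>((x, l, h), p, q). eps i * p$i$i + eps j * h$od j i * l$j + eps k * h$od k i * l$k"]
    unfolding frechet_lame_l_diag by (simp add: phi_def eta_def)
  then show "eps i * (deta i z (w i) - (\<Sum>m\<in>UNIV. dxi m z (w i) * pcol l h m $ i))
      + eps j * (phi j i z * l$j + h$od j i * eta j z)
      + eps k * (phi k i z * l$k + h$od k i * eta k z) = 0" by (simp add: dp_def)
  have "dq$od i j$k - (phi i k z * h$od k j + h$od i k * phi k j z) = 0"
    using all'[of "\<lambda>((x, l, h), p, q). q$od i j$k - h$od i k * h$od k j"]
    unfolding frechet_lame_h_third by (simp add: phi_def)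
  then show "dphi i j z (w k) - (\<Sum>m\<in>UNIV. dxi m z (w k) * Q m $ od i j)
      = phi i k z * h$od k j + h$od i k * phi k j z" by (simp add: dq_def dphi_def)
  have "dq$od i j$j + dq$od j i$i + (phi i k z * h$od j k + h$od i k * phi j k z) = 0"
    using all'[of "\<lambda>((x, l, h), p, q). q$od i j$j + q$od j i$i + h$od i k * h$od j k"]
    unfolding frechet_lame_h_skew by (simp add: phi_def)
  then show "dphi i j z (w j) - (\<Sum>m\<in>UNIV. dxi m z (w j) * Q m $ od i j)
      + (dphi j i z (w i) - (\<Sum>m\<in>UNIV. dxi m z (w i) * Q m $ od j i))
      + (phi i k z * h$od j k + h$od i k * phi j k z) = 0" by (simp add: dq_def dphi_def)
qed

end

section \<open>Tangential derivatives on the cone\<close>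

text \<open>Convexity keeps the segment from y to y + W inside B, and g is constant on it. So g and
  its translate by W agree on an open set around y, and therefore have the same derivative there; g
  need only be differentiable once.\<close>

lemma directional_invariance:
  fixes g :: "'a::real_normed_vector \<Rightarrow> real"
  assumes B: "open B" "convex B"
    and g: "\<And>y. y \<in> B \<Longrightarrow> (g has_derivative g' y) (at y)"
    and W: "\<And>y. y \<in> B \<Longrightarrow> g' y W = 0"
    and y: "y \<in> B" "y + W \<in> B"
  shows "g (y + W) = g y" and "g' (y + W) = g' y"
proof -
  have val: "g (y + W) = g y" if y: "y \<in> B" "y + W \<in> B" for y
  proof -
    have seg: "y + t *\<^sub>R W \<in> B" if "t \<in> {0..1}" for t
    proof -
      have "(1 - t) *\<^sub>R y + t *\<^sub>R (y + W) \<in> B"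
        using B(2) y that by (intro convexD) auto
      then show ?thesis by (simp add: algebra_simps)
    qed
    have "((\<lambda>t. g (y + t *\<^sub>R W)) has_derivative (\<lambda>_. 0)) (at t within {0..1})" if "t \<in> {0..1}" for t
    proof -
      have "((\<lambda>t. y + t *\<^sub>R W) has_derivative (\<lambda>s. s *\<^sub>R W)) (at t within {0..1})"
        by (auto intro!: derivative_eq_intros)
      from has_derivative_compose[OF this g[OF seg[OF that]]]
      have "((\<lambda>t. g (y + t *\<^sub>R W)) has_derivative (\<lambda>s. g' (y + t *\<^sub>R W) (s *\<^sub>R W))) (at t within {0..1})" .
      moreover have "g' (y + t *\<^sub>R W) (s *\<^sub>R W) = 0" for s
        using has_derivative_linear[OF g[OF seg[OF that]]] W[OF seg[OF that]] by (simp add: linear_scale)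
      ultimately show ?thesis by simp
    qed
    from has_derivative_zero_unique[OF convex_closed_interval this, of 1 0]
    show ?thesis by (simp add: convex_real_interval)
  qed
  show "g (y + W) = g y" using val y by simp
  have "((\<lambda>y. y + W) has_derivative (\<lambda>u. u)) (at y)"
    by (auto intro!: derivative_eq_intros)
  from has_derivative_compose[OF this g[OF y(2)]]
  have d: "((\<lambda>y. g (y + W)) has_derivative g' (y + W)) (at y)" .
  have "open (B \<inter> (\<lambda>y. y + W) -` B)"
    by (intro open_Int B open_vimage continuous_intros)
  from has_derivative_transform_within_open[OF d this, of g]
  have "(g has_derivative g' (y + W)) (at y)" using val y by auto
  then show "g' (y + W) = g' y" using g[OF y(1)] has_derivative_unique by blast
qed

text \<open>The kernel of the differential of the quadratic form in l; the x- and h-parts of the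
  vector are unrestricted.\<close>

definition cone_tangent :: "pt \<Rightarrow> pt \<Rightarrow> bool" where
  "cone_tangent z u \<longleftrightarrow> (\<Sum>i\<in>UNIV. eps i * fst (snd z) $ i * fst (snd u) $ i) = 0"

lemma has_derivative_hypot:
  fixes y :: pt
  assumes "(fst (snd y) $ 1)\<^sup>2 + (fst (snd y) $ 3)\<^sup>2 > 0"
  shows "((\<lambda>z. sqrt ((fst (snd z) $ 1)\<^sup>2 + (fst (snd z) $ 3)\<^sup>2)) has_derivative
    (\<lambda>u. (fst (snd y) $ 1 * fst (snd u) $ 1 + fst (snd y) $ 3 * fst (snd u) $ 3) /
      sqrt ((fst (snd y) $ 1)\<^sup>2 + (fst (snd y) $ 3)\<^sup>2))) (at y)"
  using assms
  apply -
  apply (rule has_derivative_eq_rhs)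
   apply (rule derivative_eq_intros bounded_linear.has_derivative[OF bounded_linear_vec_nth] refl | assumption)+
  apply (simp add: fun_eq_iff)
  apply (simp add: field_simps)
  done

text \<open>The map \<open>\<pi>\<close> retracts a ball onto the cone by recomputing \<open>l\<^sub>2\<close> from \<open>l\<^sub>1\<close> and \<open>l\<^sub>3\<close>; composing
  with it turns functions on the cone into functions on a convex open set.\<close>

lemma cone_chart:
  assumes U: "open U" "U \<subseteq> variable_space" and z0: "z0 \<in> U" "z0 \<in> cone_points"
  obtains e \<pi> \<pi>' where "e > 0"
    "\<And>y. y \<in> ball z0 e \<Longrightarrow> \<pi> y \<in> U \<inter> cone_points"
    "\<And>z. z \<in> ball z0 e \<Longrightarrow> z \<in> cone_points \<Longrightarrow> \<pi> z = z"
    "\<And>y. y \<in> ball z0 e \<Longrightarrow> (\<pi> has_derivative \<pi>' y) (at y)"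
    "\<And>z u. z \<in> ball z0 e \<Longrightarrow> z \<in> cone_points \<Longrightarrow> cone_tangent z u \<Longrightarrow> \<pi>' z u = u"
    "\<And>y u. y \<in> ball z0 e \<Longrightarrow> cone_tangent (\<pi> y) (\<pi>' y u)"
    "\<And>y u. fst (\<pi> y) = fst y \<and> fst (\<pi>' y u) = fst u"
    "\<And>y dx dh. \<pi>' y (dx, 0, dh) = (dx, 0, dh)"
proof -
  \<comment> \<open>Given l_1 and l_3, the cone has two sheets l_2 = R and l_2 = - R;
    \<open>\<sigma>\<close> selects the one through \<open>z0\<close>.\<close>
  define \<sigma> where "\<sigma> = sgn (fst (snd z0) $ 2)"
  define R where "R l = sqrt ((l$1)\<^sup>2 + (l$3)\<^sup>2)" for l :: "real^3"
  define \<pi> :: "pt \<Rightarrow> pt" where "\<pi> z = (fst z, fst (snd z) + (\<sigma> * R (fst (snd z)) - fst (snd z) $ 2) *\<^sub>R axis 2 1, snd (snd z))" for z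
  define \<pi>' :: "pt \<Rightarrow> pt \<Rightarrow> pt" where "\<pi>' z u = (fst u, fst (snd u) +
      (\<sigma> * ((fst (snd z) $ 1 * fst (snd u) $ 1 + fst (snd z) $ 3 * fst (snd u) $ 3) / R (fst (snd z)))
       - fst (snd u) $ 2) *\<^sub>R axis 2 1, snd (snd u))" for z u
  have rfix: "\<pi> z = z" if "z \<in> cone_points" "\<sigma> * fst (snd z) $ 2 > 0" for z
  proof -
    obtain x l h where z: "z = (x, l, h)" by (cases z)
    have "(l$1)\<^sup>2 + (l$3)\<^sup>2 = (l$2)\<^sup>2" using that by (simp add: z cone_points_def)
    then have "R l = \<bar>l$2\<bar>" by (simp add: R_def)
    moreover have "\<sigma> = sgn (l$2)"
      using that(2) unfolding z \<sigma>_def by (auto simp: sgn_if zero_less_mult_iff split: if_splits)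
    ultimately have "\<sigma> * R l = l$2" by (simp add: sgn_mult_abs)
    then show ?thesis by (simp add: z \<pi>_def)
  qed
  have z02: "fst (snd z0) $ 2 \<noteq> 0" using z0 by (auto simp: cone_points_def variable_space_def)
  then have \<sigma>2: "\<sigma>\<^sup>2 = 1" "\<sigma> * \<sigma> = 1" by (auto simp: \<sigma>_def sgn_if)
  have \<sigma>3: "\<sigma> * (\<sigma> * t) = t" for t using \<sigma>2(2) by (simp add: mult.assoc[symmetric])
  have pos0: "\<sigma> * fst (snd z0) $ 2 > 0" using z02 by (simp add: \<sigma>_def sgn_if)
  have cont: "continuous_on UNIV \<pi>" unfolding \<pi>_def R_def
    by (intro continuous_intros)
  \<comment> \<open>The first condition puts \<open>\<pi> y\<close> in \<open>U\<close>, so l_1 is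
    nonzero and R is differentiable at y; the second leaves only the sheet through
    \<open>z0\<close>, whose points \<open>\<pi>\<close> fixes.\<close>
  define S where "S = \<pi> -` U \<inter> {z. \<sigma> * fst (snd z) $ 2 > 0}"
  have "open S" unfolding S_def
    by (intro open_Int open_vimage U cont open_Collect_less continuous_intros)
  moreover have "z0 \<in> S" using rfix[OF z0(2) pos0] pos0 z0 by (simp add: S_def)
  ultimately obtain e where e: "e > 0" "ball z0 e \<subseteq> S" by (meson openE)
  have comp: "fst (snd (\<pi> y)) $ 1 = fst (snd y) $ 1" "fst (snd (\<pi> y)) $ 3 = fst (snd y) $ 3"
      "fst (snd (\<pi> y)) $ 2 = \<sigma> * R (fst (snd y))" for y
    by (simp_all add: \<pi>_def axis_def)
  have comp': "fst (snd (\<pi>' y u)) $ 1 = fst (snd u) $ 1" "fst (snd (\<pi>' y u)) $ 3 = fst (snd u) $ 3"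
      "fst (snd (\<pi>' y u)) $ 2 = \<sigma> * ((fst (snd y) $ 1 * fst (snd u) $ 1 + fst (snd y) $ 3 * fst (snd u) $ 3) / R (fst (snd y)))" for y u
    by (simp_all add: \<pi>'_def axis_def)
  have Rpos: "R (fst (snd y)) > 0" if "y \<in> S" for y
  proof -
    have "\<pi> y \<in> variable_space" using that U by (auto simp: S_def)
    then have "fst (snd (\<pi> y)) $ 1 \<noteq> 0" by (auto simp: variable_space_def)
    then have "fst (snd y) $ 1 \<noteq> 0" by (simp add: comp)
    then show ?thesis by (simp add: R_def add_pos_nonneg)
  qed
  show thesis
  proof (rule that[of e \<pi> \<pi>'])
    show "e > 0" by fact
    fix y
    show "fst (\<pi> y) = fst y \<and> fst (\<pi>' y u) = fst u" for u by (simp add: \<pi>_def \<pi>'_def)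
    show "\<pi>' y (dx, 0, dh) = (dx, 0, dh)" for dx dh by (simp add: \<pi>'_def)
    assume "y \<in> ball z0 e"
    then have y: "y \<in> S" using e by auto
    have "(fst (snd (\<pi> y)) $ 1)\<^sup>2 - (fst (snd (\<pi> y)) $ 2)\<^sup>2 + (fst (snd (\<pi> y)) $ 3)\<^sup>2 = 0"
      by (simp add: comp power_mult_distrib \<sigma>2 R_def)
    then show "\<pi> y \<in> U \<inter> cone_points"
      using y U by (auto simp: S_def cone_points_def split_beta)
    show "\<pi> y = y" if "y \<in> cone_points" using rfix that y by (auto simp: S_def)
    note [derivative_intros] = bounded_linear.has_derivative[OF bounded_linear_vec_nth]
    have "(fst (snd y) $ 1)\<^sup>2 + (fst (snd y) $ 3)\<^sup>2 > 0" using Rpos[OF y] by (simp add: R_def)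
    then have [derivative_intros]: "((\<lambda>z. R (fst (snd z))) has_derivative
        (\<lambda>u. (fst (snd y) $ 1 * fst (snd u) $ 1 + fst (snd y) $ 3 * fst (snd u) $ 3) / R (fst (snd y)))) (at y)"
      unfolding R_def by (rule has_derivative_hypot)
    show "(\<pi> has_derivative \<pi>' y) (at y)"
      unfolding \<pi>_def[abs_def] \<pi>'_def[abs_def]
      by (auto intro!: derivative_eq_intros)
    show "cone_tangent (\<pi> y) (\<pi>' y u)" for u
      using Rpos[OF y]
      by (simp add: cone_tangent_def sum_3 eps_def comp comp' field_simps \<sigma>3)
    show "\<pi>' y u = u" if c: "y \<in> cone_points" and t: "cone_tangent y u" for u
    proof -
      have fy: "\<pi> y = y" using rfix c y by (auto simp: S_def)
      have l2: "fst (snd y) $ 2 = \<sigma> * R (fst (snd y))" using comp(3)[of y] fy by simp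
      have "fst (snd y) $ 1 * fst (snd u) $ 1 + fst (snd y) $ 3 * fst (snd u) $ 3 = \<sigma> * R (fst (snd y)) * fst (snd u) $ 2"
        using t l2 by (simp add: cone_tangent_def sum_3 eps_def)
      then have "\<sigma> * ((fst (snd y) $ 1 * fst (snd u) $ 1 + fst (snd y) $ 3 * fst (snd u) $ 3) / R (fst (snd y)))
          = fst (snd u) $ 2"
        using Rpos[OF y] \<sigma>2 by simp
      then show ?thesis by (simp add: \<pi>'_def)
    qed
  qed
qed

text \<open>All but the last item are \<open>directional_invariance\<close> for f composed with
  \<open>\<pi>\<close> on a ball. \<open>\<pi>'\<close> fixes directions without l-part and maps
  every vector to a tangent one, so hypotheses on the tangential derivatives of f suffice; at cone
  points it fixes tangent vectors, which gives the conclusions back for f. The last item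
  differentiates the zero function.\<close>

lemma cone_transport:
  assumes U: "open U" "U \<subseteq> variable_space" and z0: "z0 \<in> U" "z0 \<in> cone_points"
  obtains e where "e > 0" "ball z0 e \<subseteq> U"
    "\<And>(f :: pt \<Rightarrow> real) f' dx dh y. (\<And>z. z \<in> U \<inter> cone_points \<Longrightarrow> (f has_derivative f' z) (at z)) \<Longrightarrow>
      (\<And>z. z \<in> U \<inter> cone_points \<Longrightarrow> f' z (dx, 0, dh) = 0) \<Longrightarrow>
      y \<in> ball z0 e \<Longrightarrow> y \<in> cone_points \<Longrightarrow> y + (dx, 0, dh) \<in> ball z0 e \<Longrightarrow>
      f (y + (dx, 0, dh)) = f y \<and> (\<forall>u. cone_tangent y u \<longrightarrow> f' (y + (dx, 0, dh)) u = f' y u)"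
    "\<And>(f :: pt \<Rightarrow> real) f' y. (\<And>z. z \<in> U \<inter> cone_points \<Longrightarrow> (f has_derivative f' z) (at z)) \<Longrightarrow>
      (\<And>z u. z \<in> U \<inter> cone_points \<Longrightarrow> cone_tangent z u \<Longrightarrow> f' z u = 0) \<Longrightarrow>
      y \<in> ball z0 e \<Longrightarrow> y \<in> cone_points \<Longrightarrow> f y = f z0"
    "\<And>(f :: pt \<Rightarrow> real) f' c i y z. (\<And>z. z \<in> U \<inter> cone_points \<Longrightarrow> (f has_derivative f' z) (at z)) \<Longrightarrow>
      (\<And>z u. z \<in> U \<inter> cone_points \<Longrightarrow> cone_tangent z u \<Longrightarrow> f' z u = c z * fst u $ i) \<Longrightarrow>
      y \<in> ball z0 e \<Longrightarrow> y \<in> cone_points \<Longrightarrow> z \<in> ball z0 e \<Longrightarrow> z \<in> cone_points \<Longrightarrow>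
      fst y $ i = fst z $ i \<Longrightarrow> c y = c z"
    "\<And>(f :: pt \<Rightarrow> real) f' u. (f has_derivative f') (at z0) \<Longrightarrow>
      (\<And>z. z \<in> U \<inter> cone_points \<Longrightarrow> f z = 0) \<Longrightarrow> cone_tangent z0 u \<Longrightarrow> f' u = 0"
proof -
  obtain e1 \<pi> \<pi>' where ch: "e1 > 0"
    "\<And>y. y \<in> ball z0 e1 \<Longrightarrow> \<pi> y \<in> U \<inter> cone_points"
    "\<And>z. z \<in> ball z0 e1 \<Longrightarrow> z \<in> cone_points \<Longrightarrow> \<pi> z = z"
    "\<And>y. y \<in> ball z0 e1 \<Longrightarrow> (\<pi> has_derivative \<pi>' y) (at y)"
    "\<And>z u. z \<in> ball z0 e1 \<Longrightarrow> z \<in> cone_points \<Longrightarrow> cone_tangent z u \<Longrightarrow> \<pi>' z u = u"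
    "\<And>y u. y \<in> ball z0 e1 \<Longrightarrow> cone_tangent (\<pi> y) (\<pi>' y u)"
    "\<And>y u. fst (\<pi> y) = fst y \<and> fst (\<pi>' y u) = fst u"
    "\<And>y dx dh. \<pi>' y (dx, 0, dh) = (dx, 0, dh)"
    by (rule cone_chart[OF U z0]) blast
  obtain e2 where e2: "e2 > 0" "ball z0 e2 \<subseteq> U" using U(1) z0(1) by (meson openE)
  define e where "e = min e1 e2"
  let ?B = "ball z0 e"
  have sub: "y \<in> ball z0 e1" if "y \<in> ?B" for y using that by (simp add: e_def)
  have B: "open ?B" "convex ?B" by auto
  have pull: "((\<lambda>y. f (\<pi> y)) has_derivative (\<lambda>u. f' (\<pi> y) (\<pi>' y u))) (at y)"
    if "\<And>z. z \<in> U \<inter> cone_points \<Longrightarrow> (f has_derivative f' z) (at z)" "y \<in> ?B"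
    for f :: "pt \<Rightarrow> real" and f' y
    using has_derivative_compose[OF ch(4)[OF sub] that(1)[OF ch(2)[OF sub]]] that(2) by blast
  show thesis
  proof (rule that[of e])
    show "e > 0" "?B \<subseteq> U" using ch(1) e2 by (auto simp: e_def)
  next
    fix f :: "pt \<Rightarrow> real" and f' dx dh y
    assume f: "\<And>z. z \<in> U \<inter> cone_points \<Longrightarrow> (f has_derivative f' z) (at z)"
      and W: "\<And>z. z \<in> U \<inter> cone_points \<Longrightarrow> f' z (dx, 0, dh) = 0"
      and y: "y \<in> ?B" "y \<in> cone_points" "y + (dx, 0, dh) \<in> ?B"
    have yW: "y + (dx, 0, dh) \<in> cone_points"
      using y(2) by (auto simp: cone_points_def variable_space_def split_beta)
    have W': "f' (\<pi> y) (\<pi>' y (dx, 0, dh)) = 0" if "y \<in> ?B" for y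
      using W ch(2)[OF sub[OF that]] ch(8) by simp
    note D = directional_invariance[OF B pull[OF f] W' y(1,3)]
    have "f (y + (dx, 0, dh)) = f y"
      using D(1) ch(3) sub y yW by simp
    moreover have "f' (y + (dx, 0, dh)) u = f' y u" if "cone_tangent y u" for u
    proof -
      have "cone_tangent (y + (dx, 0, dh)) u" using that by (simp add: cone_tangent_def)
      then show ?thesis
        using fun_cong[OF D(2), of u] ch(3,5) sub y yW that by simp
    qed
    ultimately show "f (y + (dx, 0, dh)) = f y \<and> (\<forall>u. cone_tangent y u \<longrightarrow> f' (y + (dx, 0, dh)) u = f' y u)"
      by blast
  next
    fix f :: "pt \<Rightarrow> real" and f' y
    assume f: "\<And>z. z \<in> U \<inter> cone_points \<Longrightarrow> (f has_derivative f' z) (at z)"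
      and W: "\<And>z u. z \<in> U \<inter> cone_points \<Longrightarrow> cone_tangent z u \<Longrightarrow> f' z u = 0"
      and y: "y \<in> ?B" "y \<in> cone_points"
    have "f' (\<pi> y) (\<pi>' y (y2 - z0)) = 0" if "y \<in> ?B" for y y2
      using W ch(2)[OF sub[OF that]] ch(6)[OF sub[OF that]] by blast
    from directional_invariance(1)[OF B pull[OF f] this, of z0 y]
    show "f y = f z0" using y z0 ch(1,3) sub e2 by (simp add: e_def)
  next
    fix f :: "pt \<Rightarrow> real" and f' c y z and i :: 3
    assume f: "\<And>z. z \<in> U \<inter> cone_points \<Longrightarrow> (f has_derivative f' z) (at z)"
      and W: "\<And>z u. z \<in> U \<inter> cone_points \<Longrightarrow> cone_tangent z u \<Longrightarrow> f' z u = c z * fst u $ i"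
      and y: "y \<in> ?B" "y \<in> cone_points" and z: "z \<in> ?B" "z \<in> cone_points"
      and yz: "fst y $ i = fst z $ i"
    have g': "f' (\<pi> y) (\<pi>' y u) = c (\<pi> y) * fst u $ i" if "y \<in> ?B" for y u
      using W ch(2)[OF sub[OF that]] ch(6)[OF sub[OF that]] ch(7) by auto
    have "f' (\<pi> w) (\<pi>' w (z - y)) = 0" if "w \<in> ?B" for w
      using g'[OF that] yz by simp
    \<comment> \<open>The direction z - y has i-th x-component zero, so the pulled-back derivative
      vanishes along it and is the same at both ends; \<open>axis i 1\<close> then reads off
      \<open>c\<close>. Nothing is assumed about \<open>c\<close> itself.\<close>
    from directional_invariance(2)[OF B pull[OF f] this, of y] y z
    have "(\<lambda>u. f' (\<pi> z) (\<pi>' z u)) = (\<lambda>u. f' (\<pi> y) (\<pi>' y u))" by simp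
    from fun_cong[OF this, of "(axis i 1, 0)"] have "c (\<pi> z) = c (\<pi> y)"
      unfolding g'[OF y(1)] g'[OF z(1)] by simp
    then show "c y = c z" using ch(3) sub y z by simp
  next
    fix f :: "pt \<Rightarrow> real" and f' u
    assume f: "(f has_derivative f') (at z0)"
      and W: "\<And>z. z \<in> U \<inter> cone_points \<Longrightarrow> f z = 0" and u: "cone_tangent z0 u"
    have c: "z0 \<in> ball z0 e1" using ch(1) by simp
    have "(f has_derivative f') (at (\<pi> z0))" using f ch(3)[OF c z0(2)] by simp
    from has_derivative_compose[OF ch(4)[OF c] this]
    have "((\<lambda>y. f (\<pi> y)) has_derivative (\<lambda>u. f' (\<pi>' z0 u))) (at z0)" .
    then have "((\<lambda>y. 0) has_derivative (\<lambda>u. f' (\<pi>' z0 u))) (at z0)"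
      by (rule has_derivative_transform_within_open[of _ _ _ _ "ball z0 e1"])
        (use c W ch(2) in auto)
    then have "(\<lambda>u. f' (\<pi>' z0 u)) = (\<lambda>u. 0)"
      using has_derivative_unique[OF _ has_derivative_const] by blast
    then show "f' u = 0" using ch(5)[OF c z0(2) u] by metis
  qed
qed

section \<open>Solving the determining equations\<close>

definition x_unit :: "3 \<Rightarrow> pt" where "x_unit j = (axis j 1, 0, 0)"
definition h_unit :: "offdiag \<Rightarrow> pt" where "h_unit a = (0, 0, axis a 1)"
text \<open>The infinitesimal rotation of the (l_n, l_k)-plane preserving the quadratic form; a
  Lorentz boost when the two signs differ.\<close>

definition cone_rot :: "3 \<Rightarrow> 3 \<Rightarrow> real^3 \<Rightarrow> pt" where
  "cone_rot n k l = (0, l$k *\<^sub>R axis n 1 - (eps n * eps k * l$n) *\<^sub>R axis k 1, 0)"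

text \<open>Tangency of the j-th column of derivatives of l makes it a combination of the two
  rotations involving index j, and the coefficients turn out to be the h_nj themselves. This
  exhibits the dependence on h.\<close>

lemma jvec_decomp:
  assumes d: "n \<noteq> m" "m \<noteq> j" "n \<noteq> j"
  shows "jvec j l h w = x_unit j + h$od n j *\<^sub>R cone_rot n j l + h$od m j *\<^sub>R cone_rot m j l + (0, 0, w)"
proof -
  have "pcol l h j = h$od n j *\<^sub>R (l$j *\<^sub>R axis n 1 - (eps n * eps j * l$n) *\<^sub>R axis j 1)
      + h$od m j *\<^sub>R (l$j *\<^sub>R axis m 1 - (eps m * eps j * l$m) *\<^sub>R axis j 1)"
    unfolding vec_eq_iff
  proof
    fix i
    have dj: "j \<noteq> n" "n \<noteq> m" "j \<noteq> m" using d by auto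
    have "i \<in> {n, m, j}" using distinct3_UNIV[OF d] by auto
    then consider "i = n" | "i = m" | "i = j" by blast
    then show "pcol l h j $ i = (h$od n j *\<^sub>R (l$j *\<^sub>R axis n 1 - (eps n * eps j * l$n) *\<^sub>R axis j 1)
      + h$od m j *\<^sub>R (l$j *\<^sub>R axis m 1 - (eps m * eps j * l$m) *\<^sub>R axis j 1)) $ i"
      by cases (use d dj in \<open>simp_all add: pcol_offdiag pcol_diag[OF dj] axis_def algebra_simps\<close>)
  qed
  then show ?thesis by (simp add: jvec_def x_unit_def cone_rot_def)
qed

lemma cone_rot_antisym: "cone_rot n k l = - (eps n * eps k) *\<^sub>R cone_rot k n l"
  by (simp add: cone_rot_def scaleR_diff_right mult_ac)

text \<open>Three rotations tangent to a surface must be linearly dependent at each point. The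
  relation later ties the components of eta together.\<close>

lemma cone_rot_cyclic:
  "l$k *\<^sub>R cone_rot i j l - l$j *\<^sub>R cone_rot i k l = (eps i * eps k * l$i) *\<^sub>R cone_rot k j l"
  by (simp add: cone_rot_def scaleR_diff_right mult_ac)

lemma cone_tangent_add: "cone_tangent z u \<Longrightarrow> cone_tangent z v \<Longrightarrow> cone_tangent z (u + v)"
  by (simp add: cone_tangent_def distrib_left sum.distrib)

lemma cone_tangent_scaleR: "cone_tangent z u \<Longrightarrow> cone_tangent z (c *\<^sub>R u)"
  by (simp add: cone_tangent_def mult.left_commute[of _ c] flip: sum_distrib_left)

lemma cone_tangent_x_unit: "cone_tangent z (x_unit j)"
  by (simp add: cone_tangent_def x_unit_def)

lemma cone_tangent_vertical: "cone_tangent z (0, 0, w)"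
  by (simp add: cone_tangent_def)

lemma cone_tangent_cone_rot:
  assumes "n \<noteq> k" shows "cone_tangent (x, l, h) (cone_rot n k l)"
proof -
  obtain m where m: "k \<noteq> m" "n \<noteq> m" using obtain_third[OF assms] by blast
  show ?thesis using assms m
    by (simp add: cone_tangent_def sum_distinct3[OF assms m] cone_rot_def axis_def mult_ac)
qed

text \<open>Tangency depends on l only, so the base point may carry an \<open>h'\<close> different
  from the \<open>h\<close> in the vector; this is needed when a vector belonging to a shifted h is
  used at the unshifted point.\<close>

lemma cone_tangent_jvec: "cone_tangent (x, l, h') (jvec j l h w)"
proof -
  obtain n m where "n \<noteq> m" "m \<noteq> j" "n \<noteq> j"
    by (metis obtain_third zero_neq_one)
  then show ?thesis
    by (simp add: jvec_decomp[of n m] cone_tangent_add cone_tangent_scaleR cone_tangent_x_unit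
        cone_tangent_cone_rot cone_tangent_vertical)
qed

text \<open>Since l_k is nonzero, the two rotations can be scaled to produce the n-th and m-th
  components of \<open>dl\<close>; tangency then determines the k-th.\<close>

lemma cone_tangent_decomp:
  assumes d: "n \<noteq> m" "m \<noteq> k" "n \<noteq> k" and l: "l$k \<noteq> 0"
    and t: "cone_tangent (x, l, h) (dx, dl, dh)"
  shows "(dx, dl, dh) = (\<Sum>j\<in>UNIV. dx$j *\<^sub>R x_unit j) + (dl$n / l$k) *\<^sub>R cone_rot n k l + (dl$m / l$k) *\<^sub>R cone_rot m k l + (0, 0, dh)"
proof -
  have t': "eps n * l$n * dl$n + (eps m * l$m * dl$m + eps k * l$k * dl$k) = 0"
    using t unfolding cone_tangent_def sum_distinct3[OF d] by simp
  have "eps k * (eps n * l$n * dl$n + (eps m * l$m * dl$m + eps k * l$k * dl$k)) = 0"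
    using t' by simp
  then have "dl$k * l$k = - eps k * (eps n * l$n * dl$n + eps m * l$m * dl$m)"
    by (simp add: algebra_simps)
  then have k: "dl$k = - eps k * (eps n * l$n * dl$n + eps m * l$m * dl$m) / l$k"
    using l by (simp add: field_simps)
  have "dl = (dl$n / l$k) *\<^sub>R (l$k *\<^sub>R axis n 1 - (eps n * eps k * l$n) *\<^sub>R axis k 1)
      + (dl$m / l$k) *\<^sub>R (l$k *\<^sub>R axis m 1 - (eps m * eps k * l$m) *\<^sub>R axis k 1)"
    unfolding vec_eq_iff
  proof
    fix i
    have "i \<in> {n, m, k}" using distinct3_UNIV[OF d] by auto
    then consider "i = n" | "i = m" | "i = k" by blast
    then show "dl$i = ((dl$n / l$k) *\<^sub>R (l$k *\<^sub>R axis n 1 - (eps n * eps k * l$n) *\<^sub>R axis k 1)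
      + (dl$m / l$k) *\<^sub>R (l$k *\<^sub>R axis m 1 - (eps m * eps k * l$m) *\<^sub>R axis k 1)) $ i"
    proof cases
      case 3
      then show ?thesis using d k l by (simp add: axis_def divide_simps) (simp add: algebra_simps)
    qed (use d l in \<open>simp_all add: axis_def\<close>)
  qed
  moreover have "(\<Sum>j\<in>UNIV. dx$j *\<^sub>R x_unit j) = (dx, 0, 0)"
  proof -
    have "(\<Sum>j\<in>UNIV. dx$j *\<^sub>R axis j 1) = dx"
      using basis_expansion[of dx] by (simp add: scalar_mult_eq_scaleR)
    then show ?thesis by (simp add: x_unit_def sum_prod)
  qed
  ultimately show ?thesis by (simp add: cone_rot_def)
qed

lemma linear_vertical:
  assumes "linear f" shows "f (0, 0, w) = (\<Sum>a\<in>UNIV. w$a *\<^sub>R f (h_unit a))"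
proof -
  have "(\<Sum>a\<in>UNIV. w$a *\<^sub>R axis a 1) = w"
    using basis_expansion[of w] by (simp add: scalar_mult_eq_scaleR)
  then have "(0, 0, w) = (\<Sum>a\<in>UNIV. w$a *\<^sub>R h_unit a)"
    by (simp add: h_unit_def sum_prod)
  then show ?thesis using assms by (simp add: linear_sum linear_scale)
qed

lemma jvec_add: "jvec j l h (w + w') = jvec j l h w + (0, 0, w')"
  by (simp add: jvec_def)

lemma jvec_eq: "jvec j l h w = jvec j l h 0 + (0, 0, w)"
  by (simp add: jvec_def)

text \<open>The tool for comparing an equation at h and at a shifted h: a rotation appears in a
  single direction \<open>jvec\<close>.\<close>

lemma jvec_shift:
  assumes "n \<noteq> m"
  shows "jvec j l (h + s *\<^sub>R axis (od n m) 1) w = jvec j l h w + (if m = j then s *\<^sub>R cone_rot n j l else 0)"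
proof (cases "m = j")
  case True
  obtain k where k: "m \<noteq> k" "n \<noteq> k" using obtain_third[OF assms] by blast
  then have d: "n \<noteq> k" "k \<noteq> j" "n \<noteq> j" using True assms by auto
  show ?thesis unfolding jvec_decomp[OF d] using True d
    by (simp add: axis_def od_eq_iff scaleR_add_left)
next
  case False
  obtain a b where d: "a \<noteq> b" "b \<noteq> j" "a \<noteq> j"
    by (metis obtain_third zero_neq_one)
  show ?thesis unfolding jvec_decomp[OF d] using False d assms
    by (simp add: axis_def od_eq_iff)
qed

context lame_generator
begin

lemma U_variable: "U \<subseteq> variable_space"
  using gen by (simp add: infinitesimal_generator_def)

text \<open>The translation item of \<open>cone_transport\<close> along \<open>h_unit a\<close>.
  These vectors have norm 1, so one radius serves all \<open>a\<close>.\<close>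

lemma h_shift:
  assumes "z \<in> U" "z \<in> cone_points"
  obtains e where "e > 0"
    "\<And>a s. \<bar>s\<bar> < e \<Longrightarrow> z + s *\<^sub>R h_unit a \<in> U \<inter> cone_points"
    "\<And>a s (f :: pt \<Rightarrow> real) f'. \<bar>s\<bar> < e \<Longrightarrow>
      (\<And>z. z \<in> U \<inter> cone_points \<Longrightarrow> (f has_derivative f' z) (at z)) \<Longrightarrow>
      (\<And>z. z \<in> U \<inter> cone_points \<Longrightarrow> f' z (h_unit a) = 0) \<Longrightarrow> f (z + s *\<^sub>R h_unit a) = f z"
    "\<And>a s (f :: pt \<Rightarrow> real) f' u. \<bar>s\<bar> < e \<Longrightarrow>
      (\<And>z. z \<in> U \<inter> cone_points \<Longrightarrow> (f has_derivative f' z) (at z)) \<Longrightarrow>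
      (\<And>z. z \<in> U \<inter> cone_points \<Longrightarrow> f' z (h_unit a) = 0) \<Longrightarrow> cone_tangent z u \<Longrightarrow>
      f' (z + s *\<^sub>R h_unit a) u = f' z u"
proof -
  obtain e where e: "e > 0" "ball z e \<subseteq> U"
    "\<And>(f :: pt \<Rightarrow> real) f' dx dh y. (\<And>z. z \<in> U \<inter> cone_points \<Longrightarrow> (f has_derivative f' z) (at z)) \<Longrightarrow>
      (\<And>z. z \<in> U \<inter> cone_points \<Longrightarrow> f' z (dx, 0, dh) = 0) \<Longrightarrow>
      y \<in> ball z e \<Longrightarrow> y \<in> cone_points \<Longrightarrow> y + (dx, 0, dh) \<in> ball z e \<Longrightarrow>
      f (y + (dx, 0, dh)) = f y \<and> (\<forall>u. cone_tangent y u \<longrightarrow> f' (y + (dx, 0, dh)) u = f' y u)"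
    by (rule cone_transport[OF open_U U_variable assms]) blast
  have h_unit: "s *\<^sub>R h_unit a = (0, 0, s *\<^sub>R axis a 1)" for s a by (simp add: h_unit_def)
  have ball: "z + s *\<^sub>R h_unit a \<in> ball z e" if "\<bar>s\<bar> < e" for a s
    using that by (simp add: dist_norm h_unit norm_Pair)
  have sc: "f' w (s *\<^sub>R h_unit a) = 0" if "\<And>z. z \<in> U \<inter> cone_points \<Longrightarrow> (f has_derivative f' z) (at z)"
      "\<And>z. z \<in> U \<inter> cone_points \<Longrightarrow> f' z (h_unit a) = 0" "w \<in> U \<inter> cone_points" for f :: "pt \<Rightarrow> real" and f' a s w
    using linear_scale[OF has_derivative_linear[OF that(1)[OF that(3)]]] that(2)[OF that(3)] by simp
  have main: "f (z + s *\<^sub>R h_unit a) = f z \<and> (\<forall>u. cone_tangent z u \<longrightarrow> f' (z + s *\<^sub>R h_unit a) u = f' z u)"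
    if "\<bar>s\<bar> < e" "\<And>z. z \<in> U \<inter> cone_points \<Longrightarrow> (f has_derivative f' z) (at z)"
      "\<And>z. z \<in> U \<inter> cone_points \<Longrightarrow> f' z (h_unit a) = 0" for f :: "pt \<Rightarrow> real" and f' a s
    using e(3)[of f f' 0 "s *\<^sub>R axis a 1" z] sc[of f f' a _ s] that ball[OF that(1), of a] e(1) assms
    unfolding h_unit by auto
  show thesis
  proof (rule that[of e])
    show "e > 0" by fact
    show "z + s *\<^sub>R h_unit a \<in> U \<inter> cone_points" if "\<bar>s\<bar> < e" for a s
    proof -
      have "z + s *\<^sub>R h_unit a \<in> cone_points"
        using assms(2) by (auto simp: cone_points_def variable_space_def split_beta h_unit)
      then show ?thesis using ball[OF that] e(2) by blast
    qed
  qed (use main in blast)+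
qed

section \<open>The coefficients \<open>xi\<close>\<close>

lemma linear_dxi: "z \<in> U \<Longrightarrow> linear (dxi i z)"
  and linear_deta: "z \<in> U \<Longrightarrow> linear (deta i z)"
  and linear_dphi: "z \<in> U \<Longrightarrow> linear (dphi i j z)"
  using has_derivative_xi has_derivative_eta has_derivative_phi has_derivative_linear by blast+

text \<open>In the equation for the derivative of h_ij in x_k, the term
  \<open>dxi i z (w k) * Q i $ od i j\<close> is the only one to notice the perturbation for the
  pair i, j. Its coefficient must vanish.\<close>

lemma dxi_jvec_admissible:
  assumes z: "(x, l, h) \<in> U" "(x, l, h) \<in> cone_points" and Q: "admissible h Q" and "i \<noteq> k"
  shows "dxi i (x, l, h) (jvec k l h (Q k)) = 0"
proof -
  obtain j where j: "k \<noteq> j" "i \<noteq> j" using obtain_third[OF \<open>i \<noteq> k\<close>] by blast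
  then have d: "i \<noteq> j" "j \<noteq> k" "i \<noteq> k" using assms by auto
  let ?Q = "Q(i := Q i + 1 *\<^sub>R axis (od i j) 1, j := Q j - (1 * eps i * eps j) *\<^sub>R axis (od j i) 1)"
  have Q': "admissible h ?Q" by (rule admissible_perturb2[OF Q d(1)])
  have "?Q k = Q k" "?Q i $ od i j = Q i $ od i j + 1" "?Q j $ od i j = Q j $ od i j"
    "?Q k $ od i j = Q k $ od i j"
    using d by (auto simp: axis_def od_eq_iff)
  with determining(3)[OF z Q d] determining(3)[OF z Q' d] show ?thesis
    unfolding sum_distinct3[OF d] by (simp add: algebra_simps)
qed

lemma dxi_h_unit:
  assumes z: "z \<in> U" "z \<in> cone_points"
  shows "dxi i z (h_unit a) = 0"
proof -
  obtain x l h where zz: "z = (x, l, h)" by (cases z)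
  obtain Q where Q: "admissible h Q" using admissible_exists by blast
  have *: "dxi i z (h_unit b) = 0" if "admissible h Q'" "Q' k = Q k + 1 *\<^sub>R axis b 1" "i \<noteq> k" for Q' k b
  proof -
    have "dxi i z (jvec k l h (Q k + axis b 1)) = 0" "dxi i z (jvec k l h (Q k)) = 0"
      using dxi_jvec_admissible[OF z[unfolded zz] that(1) that(3)]
        dxi_jvec_admissible[OF z[unfolded zz] Q that(3)] that(2) by (simp_all add: zz)
    then show ?thesis
      unfolding jvec_add by (simp add: linear_add[OF linear_dxi[OF z(1)]] h_unit_def)
  qed
  obtain m n where a: "a = od m n" "m \<noteq> n" by (rule offdiag_cases)
  show ?thesis
  \<comment> \<open>The component od m n can be varied both in column m and in column n, by the two
    perturbations; the column chosen must differ from i.\<close>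
  proof (cases "i = n")
    case True
    then have "i \<noteq> m" using a by auto
    then show ?thesis unfolding a
      by (intro *[OF admissible_perturb2[OF Q a(2), of 1], of m]) (use a in auto)
  next
    case False
    then show ?thesis unfolding a
      by (intro *[OF admissible_perturb1[OF Q a(2)[symmetric], of 1], of n]) (use a in auto)
  qed
qed

lemma dxi_vertical:
  assumes z: "z \<in> U" "z \<in> cone_points"
  shows "dxi i z (0, 0, w) = 0"
  using linear_vertical[OF linear_dxi[OF z(1)]] dxi_h_unit[OF z] by simp

lemma dxi_jvec_eq:
  assumes z: "z \<in> U" "z \<in> cone_points"
  shows "dxi i z (jvec k l h w) = dxi i z (jvec k l h 0)"
  unfolding jvec_eq[of _ _ _ w] using dxi_vertical[OF z] by (simp add: linear_add[OF linear_dxi[OF z(1)]])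

lemma dxi_jvec:
  assumes "(x, l, h) \<in> U" "(x, l, h) \<in> cone_points" "i \<noteq> k"
  shows "dxi i (x, l, h) (jvec k l h w) = 0"
  using dxi_jvec_admissible[OF assms(1,2) _ assms(3)] admissible_exists[of h]
    dxi_jvec_eq[OF assms(1,2)] by metis

text \<open>If i differs from k, \<open>dxi i\<close> kills \<open>jvec k\<close> for h and for h
  shifted in h_nk, and the two vectors differ by a multiple of the rotation. If i = k, the rotation
  is traded for the one with its indices exchanged.\<close>

lemma dxi_cone_rot:
  assumes z: "(x, l, h) \<in> U" "(x, l, h) \<in> cone_points" and nk: "n \<noteq> k"
  shows "dxi i (x, l, h) (cone_rot n k l) = 0"
proof -
  have *: "dxi i (x, l, h) (cone_rot n k l) = 0" if "n \<noteq> k" "i \<noteq> k" for n k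
  proof -
    let ?z = "(x, l, h)"
    obtain e where e: "e > 0"
      "\<And>a s. \<bar>s\<bar> < e \<Longrightarrow> ?z + s *\<^sub>R h_unit a \<in> U \<inter> cone_points"
      "\<And>a s (f :: pt \<Rightarrow> real) f' u. \<bar>s\<bar> < e \<Longrightarrow>
        (\<And>z. z \<in> U \<inter> cone_points \<Longrightarrow> (f has_derivative f' z) (at z)) \<Longrightarrow>
        (\<And>z. z \<in> U \<inter> cone_points \<Longrightarrow> f' z (h_unit a) = 0) \<Longrightarrow> cone_tangent ?z u \<Longrightarrow>
        f' (?z + s *\<^sub>R h_unit a) u = f' ?z u"
      by (rule h_shift[OF z]) blast
    let ?s = "e / 2" and ?a = "od n k"
    have s: "\<bar>?s\<bar> < e" using e(1) by simp
    have zs: "?z + ?s *\<^sub>R h_unit ?a = (x, l, h + ?s *\<^sub>R axis ?a 1)" by (simp add: h_unit_def)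
    have "0 = dxi i (?z + ?s *\<^sub>R h_unit ?a) (jvec k l (h + ?s *\<^sub>R axis ?a 1) 0)"
      using dxi_jvec[of x l "h + ?s *\<^sub>R axis ?a 1" i k 0] e(2)[OF s, of ?a] that unfolding zs by simp
    also have "\<dots> = dxi i ?z (jvec k l (h + ?s *\<^sub>R axis ?a 1) 0)"
      by (rule e(3)[OF s]) (auto intro: has_derivative_xi dxi_h_unit cone_tangent_jvec)
    also have "\<dots> = ?s * dxi i ?z (cone_rot n k l)"
      unfolding jvec_shift[OF that(1)]
      using dxi_jvec[OF z that(2)] by (simp add: linear_add linear_scale linear_dxi[OF z(1)])
    finally show ?thesis using e(1) by simp
  qed
  show ?thesis
  proof (cases "i = k")
    case True
    then have "dxi i (x, l, h) (cone_rot k n l) = 0" using * nk by auto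
    then show ?thesis
      unfolding cone_rot_antisym[of n k] by (simp add: linear_neg linear_scale linear_dxi[OF z(1)])
  qed (use * nk in blast)
qed

text \<open>The future constant c, before its independence of \<open>i\<close> and of the point is
  known.\<close>

definition rate where "rate i z = dxi i z (x_unit i)"

lemma dxi_x_unit:
  assumes z: "(x, l, h) \<in> U" "(x, l, h) \<in> cone_points"
  shows "dxi i (x, l, h) (x_unit j) = (if i = j then rate i (x, l, h) else 0)"
proof (cases "i = j")
  case False
  obtain k where k: "j \<noteq> k" "i \<noteq> k" using obtain_third[OF False] by blast
  then have d: "i \<noteq> k" "k \<noteq> j" "i \<noteq> j" using False by auto
  have "dxi i (x, l, h) (jvec j l h 0) = dxi i (x, l, h) (x_unit j)"
    unfolding jvec_decomp[OF d]
    using dxi_cone_rot[OF z d(2)] dxi_cone_rot[OF z d(3)]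
    by (simp add: linear_add linear_scale linear_0 linear_dxi[OF z(1)] flip: zero_prod_def)
  then show ?thesis using dxi_jvec[OF z False] False by simp
qed (simp add: rate_def)

lemma dxi_jvec_diag:
  assumes z: "(x, l, h) \<in> U" "(x, l, h) \<in> cone_points"
  shows "dxi i (x, l, h) (jvec j l h w) = (if i = j then rate i (x, l, h) else 0)"
proof -
  obtain n m where d: "n \<noteq> m" "m \<noteq> j" "n \<noteq> j"
    by (metis obtain_third zero_neq_one)
  show ?thesis unfolding jvec_decomp[OF d]
    using dxi_cone_rot[OF z d(2)] dxi_cone_rot[OF z d(3)] dxi_vertical[OF z] dxi_x_unit[OF z]
    by (simp add: linear_add linear_scale linear_dxi[OF z(1)])
qed

end

lemma directional_derivative_unique:
  fixes f :: "'a::real_normed_vector \<Rightarrow> real"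
  assumes f: "(f has_derivative f') (at z)" and "e > 0"
    and eq: "\<And>s. \<bar>s\<bar> < e \<Longrightarrow> f (z + s *\<^sub>R W) = f z + s * b"
  shows "f' W = b"
proof -
  have "((\<lambda>s. z + s *\<^sub>R W) has_derivative (\<lambda>s. s *\<^sub>R W)) (at 0)"
    by (auto intro!: derivative_eq_intros)
  moreover have "(f has_derivative f') (at (z + 0 *\<^sub>R W))" using f by simp
  ultimately have "((\<lambda>s. f (z + s *\<^sub>R W)) has_derivative (\<lambda>s. f' (s *\<^sub>R W))) (at 0)"
    by (rule has_derivative_compose)
  then have "((\<lambda>s. f z + s * b) has_derivative (\<lambda>s. f' (s *\<^sub>R W))) (at 0)"
    by (rule has_derivative_transform_within_open[of _ _ _ _ "ball 0 e"])
      (use eq \<open>e > 0\<close> in auto)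
  moreover have "((\<lambda>s. f z + s * b) has_derivative (\<lambda>s. s * b)) (at 0)"
    by (auto intro!: derivative_eq_intros)
  ultimately have "(\<lambda>s. f' (s *\<^sub>R W)) = (\<lambda>s. s * b)" by (rule has_derivative_unique)
  from fun_cong[OF this, of 1] show ?thesis by simp
qed

section \<open>The coefficients \<open>eta\<close>, and the dependence of \<open>phi\<close> on
  h\<close>

context lame_generator
begin

text \<open>In the equation for l_i,x_j the free parameters enter only through the vertical part of
  \<open>jvec j\<close>, which \<open>dxi\<close> already ignores. Subtracting the equations for two
  choices of column j, with j different from i, leaves \<open>deta i\<close>.\<close>

lemma deta_h_unit:
  assumes z: "z \<in> U" "z \<in> cone_points"
  shows "deta i z (h_unit a) = 0"
proof -
  obtain x l h where zz: "z = (x, l, h)" by (cases z)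
  obtain Q where Q: "admissible h Q" using admissible_exists by blast
  have *: "deta i z (h_unit b) = 0" if Q': "admissible h Q'" "Q' j = Q j + 1 *\<^sub>R axis b 1" and ij: "i \<noteq> j" for Q' j b
  proof -
    obtain k where k: "j \<noteq> k" "i \<noteq> k" using obtain_third[OF ij] by blast
    note dx = dxi_jvec_eq[OF z, unfolded zz]
    have "deta i z (jvec j l h (Q j + axis b 1)) = deta i z (jvec j l h (Q j))"
      using determining(1)[OF z[unfolded zz] Q ij k] determining(1)[OF z[unfolded zz] Q'(1) ij k]
      unfolding dx[of _ _ _ _ "Q j"] dx[of _ _ _ _ "Q' j"] using Q'(2) by (simp add: zz)
    then show ?thesis
      unfolding jvec_add by (simp add: linear_add[OF linear_deta[OF z(1)]] h_unit_def)
  qed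
  obtain m n where a: "a = od m n" "m \<noteq> n" by (rule offdiag_cases)
  show ?thesis
  proof (cases "i = n")
    case True
    then have "i \<noteq> m" using a by auto
    then show ?thesis unfolding a
      by (intro *[OF admissible_perturb2[OF Q a(2), of 1], of m]) (use a in auto)
  next
    case False
    then show ?thesis unfolding a
      by (intro *[OF admissible_perturb1[OF Q a(2)[symmetric], of 1], of n]) (use a in auto)
  qed
qed

lemma deta_vertical:
  assumes z: "z \<in> U" "z \<in> cone_points"
  shows "deta i z (0, 0, w) = 0"
  using linear_vertical[OF linear_deta[OF z(1)]] deta_h_unit[OF z] by simp

lemma deta_jvec_eq:
  assumes z: "z \<in> U" "z \<in> cone_points"
  shows "deta i z (jvec k l h w) = deta i z (jvec k l h 0)"
  unfolding jvec_eq[of _ _ _ w] using deta_vertical[OF z] by (simp add: linear_add[OF linear_deta[OF z(1)]])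

text \<open>What is known of \<open>dxi\<close> reduces each sum over m to a single term with
  \<open>rate\<close>, and \<open>deta\<close> no longer sees the vertical part, so the equations
  for l are free of \<open>Q\<close>.\<close>

lemma determining_reduced:
  assumes z: "(x, l, h) \<in> U" "(x, l, h) \<in> cone_points" and d: "i \<noteq> j" "j \<noteq> k" "i \<noteq> k"
  defines "z \<equiv> (x, l, h)"
  shows determining_l_offdiag: "deta i z (jvec j l h 0)
      = rate j z * (h$od i j * l$j) + phi i j z * l$j + h$od i j * eta j z"
    and determining_l_diag: "eps i * (deta i z (jvec i l h 0) - rate i z * pcol l h i $ i)
      + eps j * (phi j i z * l$j + h$od j i * eta j z)
      + eps k * (phi k i z * l$k + h$od k i * eta k z) = 0"
    and determining_h_third: "admissible h Q \<Longrightarrow> dphi i j z (jvec k l h (Q k)) - rate k z * (h$od i k * h$od k j)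
      = phi i k z * h$od k j + h$od i k * phi k j z"
    and determining_h_skew: "admissible h Q \<Longrightarrow> dphi i j z (jvec j l h (Q j)) - rate j z * Q j $ od i j
      + (dphi j i z (jvec i l h (Q i)) - rate i z * Q i $ od j i)
      + (phi i k z * h$od j k + h$od i k * phi j k z) = 0"
proof -
  have dx: "dxi m z (jvec n l h w) = (if m = n then rate m z else 0)" for m n w
    using dxi_jvec_diag[OF z] by (simp add: z_def)
  have d': "j \<noteq> i" "k \<noteq> j" "k \<noteq> i" using d by auto
  have de: "deta m z (jvec n l h w) = deta m z (jvec n l h 0)" for m n w
    using deta_jvec_eq[OF z] by (simp add: z_def)
  obtain R where R: "admissible h R" using admissible_exists by blast
  note D = determining[OF z _ d, folded z_def, unfolded sum_distinct3[OF d] dx]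
  show "deta i z (jvec j l h 0)
      = rate j z * (h$od i j * l$j) + phi i j z * l$j + h$od i j * eta j z"
    using D(1)[OF R] de[of i j "R j"] d d' by (simp add: pcol_offdiag)
  show "eps i * (deta i z (jvec i l h 0) - rate i z * pcol l h i $ i)
      + eps j * (phi j i z * l$j + h$od j i * eta j z)
      + eps k * (phi k i z * l$k + h$od k i * eta k z) = 0"
    using D(2)[OF R] de[of i i "R i"] d d' by simp
  assume Q: "admissible h Q"
  have "Q k $ od i j = h$od i k * h$od k j" using Q d by (auto simp: admissible_def)
  then show "dphi i j z (jvec k l h (Q k)) - rate k z * (h$od i k * h$od k j)
      = phi i k z * h$od k j + h$od i k * phi k j z"
    using D(3)[OF Q] d d' by simp
  show "dphi i j z (jvec j l h (Q j)) - rate j z * Q j $ od i j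
      + (dphi j i z (jvec i l h (Q i)) - rate i z * Q i $ od j i)
      + (phi i k z * h$od j k + h$od i k * phi j k z) = 0"
    using D(4)[OF Q] d d' by simp
qed

text \<open>In the equation for the derivative of h_ij in x_k, column k of \<open>Q\<close> now
  survives only inside \<open>dphi i j\<close>, while both perturbations involving k can move
  it.\<close>

lemma dphi_h_unit_third:
  assumes z: "z \<in> U" "z \<in> cone_points" and d: "i \<noteq> j" "j \<noteq> k" "i \<noteq> k" and m: "m \<noteq> k"
  shows "dphi i j z (h_unit (od m k)) = 0" and "dphi i j z (h_unit (od k m)) = 0"
proof -
  obtain x l h where zz: "z = (x, l, h)" by (cases z)
  obtain Q where Q: "admissible h Q" using admissible_exists by blast
  have *: "dphi i j z (h_unit b) = 0" if Q': "admissible h Q'" "Q' k = Q k + 1 *\<^sub>R axis b 1" for Q' b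
  proof -
    have "dphi i j z (jvec k l h (Q k + axis b 1)) = dphi i j z (jvec k l h (Q k))"
      using determining_h_third[OF z[unfolded zz] d Q] determining_h_third[OF z[unfolded zz] d Q'(1)] Q'(2) by (simp add: zz)
    then show ?thesis
      unfolding jvec_add by (simp add: linear_add[OF linear_dphi[OF z(1)]] h_unit_def)
  qed
  show "dphi i j z (h_unit (od m k)) = 0"
    by (rule *[OF admissible_perturb1[OF Q m[symmetric], of 1]]) (use m in auto)
  show "dphi i j z (h_unit (od k m)) = 0"
    by (rule *[OF admissible_perturb2[OF Q m[symmetric], of 1]]) (use m in auto)
qed

lemma dphi_h_unit_other:
  assumes z: "z \<in> U" "z \<in> cone_points" and ij: "i \<noteq> j" and a: "a \<noteq> od i j" "a \<noteq> od j i"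
  shows "dphi i j z (h_unit a) = 0"
proof -
  obtain k where k: "j \<noteq> k" "i \<noteq> k" using obtain_third[OF ij] by blast
  obtain m n where mn: "a = od m n" "m \<noteq> n" by (rule offdiag_cases)
  have "m \<in> {i, j, k}" "n \<in> {i, j, k}" using distinct3_UNIV[OF ij k] by auto
  then have "m = k \<or> n = k" using a mn by auto
  then show ?thesis using dphi_h_unit_third[OF z ij k] mn by auto
qed

text \<open>The quantity \<open>b\<^sub>i\<^sub>j\<close> of the header: \<open>twist i j - rate j\<close> will be the coefficient of \<open>h\<^sub>i\<^sub>j\<close>
  in \<open>\<phi>\<^sub>i\<^sub>j\<close>.\<close>

definition twist where
  "twist i j z = (deta i z (cone_rot i j (fst (snd z))) - eta j z) / fst (snd z) $ j"

lemma h_shift_values: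
  assumes z: "(x, l, h) \<in> U" "(x, l, h) \<in> cone_points"
  obtains e where "e > 0"
    "\<And>a s. \<bar>s\<bar> < e \<Longrightarrow> (x, l, h + s *\<^sub>R axis a 1) \<in> U"
    "\<And>a s. \<bar>s\<bar> < e \<Longrightarrow> (x, l, h + s *\<^sub>R axis a 1) \<in> cone_points"
    "\<And>a s i. \<bar>s\<bar> < e \<Longrightarrow> eta i (x, l, h + s *\<^sub>R axis a 1) = eta i (x, l, h)"
    "\<And>a s i. \<bar>s\<bar> < e \<Longrightarrow> rate i (x, l, h + s *\<^sub>R axis a 1) = rate i (x, l, h)"
    "\<And>a s i u. \<bar>s\<bar> < e \<Longrightarrow> cone_tangent (x, l, h) u \<Longrightarrow>
      deta i (x, l, h + s *\<^sub>R axis a 1) u = deta i (x, l, h) u"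
    "\<And>a s i j. \<bar>s\<bar> < e \<Longrightarrow> i \<noteq> j \<Longrightarrow> a \<noteq> od i j \<Longrightarrow> a \<noteq> od j i \<Longrightarrow>
      phi i j (x, l, h + s *\<^sub>R axis a 1) = phi i j (x, l, h)"
    "\<And>a s i j u. \<bar>s\<bar> < e \<Longrightarrow> i \<noteq> j \<Longrightarrow> a \<noteq> od i j \<Longrightarrow> a \<noteq> od j i \<Longrightarrow> cone_tangent (x, l, h) u \<Longrightarrow>
      dphi i j (x, l, h + s *\<^sub>R axis a 1) u = dphi i j (x, l, h) u"
proof -
  obtain e where e: "e > 0"
    "\<And>a s. \<bar>s\<bar> < e \<Longrightarrow> (x, l, h) + s *\<^sub>R h_unit a \<in> U \<inter> cone_points"
    "\<And>a s (f :: pt \<Rightarrow> real) f'. \<bar>s\<bar> < e \<Longrightarrow>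
      (\<And>z. z \<in> U \<inter> cone_points \<Longrightarrow> (f has_derivative f' z) (at z)) \<Longrightarrow>
      (\<And>z. z \<in> U \<inter> cone_points \<Longrightarrow> f' z (h_unit a) = 0) \<Longrightarrow> f ((x, l, h) + s *\<^sub>R h_unit a) = f (x, l, h)"
    "\<And>a s (f :: pt \<Rightarrow> real) f' u. \<bar>s\<bar> < e \<Longrightarrow>
      (\<And>z. z \<in> U \<inter> cone_points \<Longrightarrow> (f has_derivative f' z) (at z)) \<Longrightarrow>
      (\<And>z. z \<in> U \<inter> cone_points \<Longrightarrow> f' z (h_unit a) = 0) \<Longrightarrow> cone_tangent (x, l, h) u \<Longrightarrow>
      f' ((x, l, h) + s *\<^sub>R h_unit a) u = f' (x, l, h) u"
    by (rule h_shift[OF z]) blast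
  have zs: "(x, l, h) + s *\<^sub>R h_unit a = (x, l, h + s *\<^sub>R axis a 1)" for s a by (simp add: h_unit_def)
  note e = e[unfolded zs]
  show thesis
  proof (rule that[OF e(1)])
    fix a s assume s: "\<bar>s\<bar> < e"
    show "(x, l, h + s *\<^sub>R axis a 1) \<in> U" "(x, l, h + s *\<^sub>R axis a 1) \<in> cone_points"
      using e(2)[OF s] by blast+
    show "eta i (x, l, h + s *\<^sub>R axis a 1) = eta i (x, l, h)" for i
      by (rule e(3)[OF s, of "eta i" "deta i"]) (auto intro: has_derivative_eta deta_h_unit)
    show "rate i (x, l, h + s *\<^sub>R axis a 1) = rate i (x, l, h)" for i
      unfolding rate_def by (rule e(4)[OF s, of "xi i" "dxi i"])
        (auto intro: has_derivative_xi dxi_h_unit cone_tangent_x_unit)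
    show "deta i (x, l, h + s *\<^sub>R axis a 1) u = deta i (x, l, h) u" if "cone_tangent (x, l, h) u" for i u
      by (rule e(4)[OF s, of "eta i" "deta i"]) (use that in \<open>auto intro: has_derivative_eta deta_h_unit\<close>)
    show "phi i j (x, l, h + s *\<^sub>R axis a 1) = phi i j (x, l, h)"
      if "i \<noteq> j" "a \<noteq> od i j" "a \<noteq> od j i" for i j
      by (rule e(3)[OF s, of "phi i j" "dphi i j"])
        (use that in \<open>auto intro: has_derivative_phi dphi_h_unit_other\<close>)
    show "dphi i j (x, l, h + s *\<^sub>R axis a 1) u = dphi i j (x, l, h) u"
      if "i \<noteq> j" "a \<noteq> od i j" "a \<noteq> od j i" "cone_tangent (x, l, h) u" for i j u
      by (rule e(4)[OF s, of "phi i j" "dphi i j"])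
        (use that in \<open>auto intro: has_derivative_phi dphi_h_unit_other\<close>)
  qed
qed

lemma axis_od: "i \<noteq> j \<Longrightarrow> m \<noteq> n \<Longrightarrow> axis (od m n) 1 $ od i j = (if i = m \<and> j = n then 1 else 0 :: real)"
  by (auto simp: axis_def od_eq_iff)

lemma l_nonzero: "(x, l, h) \<in> cone_points \<Longrightarrow> l$i \<noteq> 0"
  by (simp add: cone_points_def variable_space_def)

text \<open>The shift of h_kj leaves every term of the equation for l_i,x_j unchanged except
  \<open>jvec j\<close>, which gains a multiple of this rotation.\<close>

lemma deta_cone_rot_third:
  assumes z: "(x, l, h) \<in> U" "(x, l, h) \<in> cone_points" and d: "i \<noteq> j" "j \<noteq> k" "i \<noteq> k"
  shows "deta i (x, l, h) (cone_rot k j l) = 0"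
proof -
  obtain e where e: "e > 0"
    "\<And>a s. \<bar>s\<bar> < e \<Longrightarrow> (x, l, h + s *\<^sub>R axis a 1) \<in> U"
    "\<And>a s. \<bar>s\<bar> < e \<Longrightarrow> (x, l, h + s *\<^sub>R axis a 1) \<in> cone_points"
    "\<And>a s i. \<bar>s\<bar> < e \<Longrightarrow> eta i (x, l, h + s *\<^sub>R axis a 1) = eta i (x, l, h)"
    "\<And>a s i. \<bar>s\<bar> < e \<Longrightarrow> rate i (x, l, h + s *\<^sub>R axis a 1) = rate i (x, l, h)"
    "\<And>a s i u. \<bar>s\<bar> < e \<Longrightarrow> cone_tangent (x, l, h) u \<Longrightarrow>
      deta i (x, l, h + s *\<^sub>R axis a 1) u = deta i (x, l, h) u"
    "\<And>a s i j. \<bar>s\<bar> < e \<Longrightarrow> i \<noteq> j \<Longrightarrow> a \<noteq> od i j \<Longrightarrow> a \<noteq> od j i \<Longrightarrow>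
      phi i j (x, l, h + s *\<^sub>R axis a 1) = phi i j (x, l, h)"
    by (rule h_shift_values[OF z]) blast
  have s: "\<bar>e/2\<bar> < e" using e(1) by simp
  have a: "od k j \<noteq> od i j" "od k j \<noteq> od j i" "k \<noteq> j" using d by (auto simp: od_eq_iff)
  have "deta i (x, l, h) (jvec j l h 0 + (e/2) *\<^sub>R cone_rot k j l) = deta i (x, l, h) (jvec j l h 0)"
    using determining_l_offdiag[OF z d] determining_l_offdiag[OF e(2,3)[OF s, of "od k j"] d]
    unfolding e(4,5)[OF s] e(7)[OF s d(1) a(1,2)] e(6)[OF s cone_tangent_jvec]
    unfolding jvec_shift[OF a(3)]
    using d by (simp add: axis_od a(3))
  then show ?thesis using e(1) by (simp add: linear_add linear_scale linear_deta[OF z(1)])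
qed

text \<open>Since l_j is nonzero, the equation for l_i,x_j can be solved for \<open>phi i j\<close>.
  The result is affine in h_ij and free of h_ji; \<open>twist\<close> is defined so that the slope
  is \<open>twist i j z - rate j z\<close>.\<close>

lemma phi_h_shift:
  assumes z: "(x, l, h) \<in> U" "(x, l, h) \<in> cone_points" and ij: "i \<noteq> j"
  obtains e where "e > 0"
    "\<And>s. \<bar>s\<bar> < e \<Longrightarrow> phi i j (x, l, h + s *\<^sub>R axis (od j i) 1) = phi i j (x, l, h)"
    "\<And>s. \<bar>s\<bar> < e \<Longrightarrow> phi i j (x, l, h + s *\<^sub>R axis (od i j) 1)
      = phi i j (x, l, h) + s * (twist i j (x, l, h) - rate j (x, l, h))"
proof -
  obtain e where e: "e > 0"
    "\<And>a s. \<bar>s\<bar> < e \<Longrightarrow> (x, l, h + s *\<^sub>R axis a 1) \<in> U"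
    "\<And>a s. \<bar>s\<bar> < e \<Longrightarrow> (x, l, h + s *\<^sub>R axis a 1) \<in> cone_points"
    "\<And>a s i. \<bar>s\<bar> < e \<Longrightarrow> eta i (x, l, h + s *\<^sub>R axis a 1) = eta i (x, l, h)"
    "\<And>a s i. \<bar>s\<bar> < e \<Longrightarrow> rate i (x, l, h + s *\<^sub>R axis a 1) = rate i (x, l, h)"
    "\<And>a s i u. \<bar>s\<bar> < e \<Longrightarrow> cone_tangent (x, l, h) u \<Longrightarrow>
      deta i (x, l, h + s *\<^sub>R axis a 1) u = deta i (x, l, h) u"
    by (rule h_shift_values[OF z]) blast
  obtain k where k: "j \<noteq> k" "i \<noteq> k" using obtain_third[OF ij] by blast
  note d = ij k
  have l: "l$j \<noteq> 0" using l_nonzero[OF z(2)] .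
  have "phi i j (x, l, h + s *\<^sub>R axis (od j i) 1) = phi i j (x, l, h)" if s: "\<bar>s\<bar> < e" for s
    using determining_l_offdiag[OF z d] determining_l_offdiag[OF e(2,3)[OF s, of "od j i"] d]
    unfolding e(4,5)[OF s] e(6)[OF s cone_tangent_jvec]
    unfolding jvec_shift[OF ij[symmetric]]
    using d l by (simp add: axis_od)
  moreover have "phi i j (x, l, h + s *\<^sub>R axis (od i j) 1)
      = phi i j (x, l, h) + s * (twist i j (x, l, h) - rate j (x, l, h))" if s: "\<bar>s\<bar> < e" for s
  proof -
    let ?z = "(x, l, h)" and ?z' = "(x, l, h + s *\<^sub>R axis (od i j) 1)"
    have "deta i ?z (jvec j l h 0) + s * deta i ?z (cone_rot i j l)
        = rate j ?z * ((h$od i j + s) * l$j) + phi i j ?z' * l$j + (h$od i j + s) * eta j ?z"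
      using determining_l_offdiag[OF e(2,3)[OF s, of "od i j"] d]
      unfolding e(4,5)[OF s] e(6)[OF s cone_tangent_jvec]
    unfolding jvec_shift[OF ij]
      using ij by (simp add: axis_od linear_add linear_scale linear_deta[OF z(1)])
    then have "(phi i j ?z' - phi i j ?z) * l$j = s * (deta i ?z (cone_rot i j l) - eta j ?z - rate j ?z * l$j)"
      using determining_l_offdiag[OF z d] by (simp add: algebra_simps)
    moreover have "(twist i j ?z - rate j ?z) * l$j = deta i ?z (cone_rot i j l) - eta j ?z - rate j ?z * l$j"
      using l by (simp add: twist_def field_simps)
    ultimately have "(phi i j ?z' - phi i j ?z) * l$j = s * (twist i j ?z - rate j ?z) * l$j"
      by (simp add: mult.assoc)
    then show ?thesis using l by simp
  qed
  ultimately show thesis using that[OF e(1)] by blast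
qed

lemma dphi_h_unit:
  assumes z: "z \<in> U" "z \<in> cone_points" and ij: "i \<noteq> j"
  shows "dphi i j z (h_unit a) = (if a = od i j then twist i j z - rate j z else 0)"
proof -
  obtain x l h where zz: "z = (x, l, h)" by (cases z)
  have zs: "(x, l, h) + s *\<^sub>R h_unit a = (x, l, h + s *\<^sub>R axis a 1)" for s a by (simp add: h_unit_def)
  obtain e where e: "e > 0"
    "\<And>s. \<bar>s\<bar> < e \<Longrightarrow> phi i j (x, l, h + s *\<^sub>R axis (od j i) 1) = phi i j (x, l, h)"
    "\<And>s. \<bar>s\<bar> < e \<Longrightarrow> phi i j (x, l, h + s *\<^sub>R axis (od i j) 1)
      = phi i j (x, l, h) + s * (twist i j (x, l, h) - rate j (x, l, h))"
    by (rule phi_h_shift[OF z[unfolded zz] ij]) blast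
  note D = directional_derivative_unique[OF has_derivative_phi[OF z(1)[unfolded zz], of i j] e(1)]
  note D1 = D[of "h_unit (od i j)" "twist i j (x, l, h) - rate j (x, l, h)", unfolded zs, OF e(3)]
  note D2 = D[of "h_unit (od j i)" 0, unfolded zs]
  consider "a = od i j" | "a = od j i" "a \<noteq> od i j" | "a \<noteq> od j i" "a \<noteq> od i j" by blast
  then show ?thesis
    by cases (use D1 D2 e(2) dphi_h_unit_other[OF z ij] in \<open>auto simp: zz\<close>)
qed

lemma dphi_vertical:
  assumes z: "z \<in> U" "z \<in> cone_points" and ij: "i \<noteq> j"
  shows "dphi i j z (0, 0, w) = w $ od i j * (twist i j z - rate j z)"
  unfolding linear_vertical[OF linear_dphi[OF z(1)]] dphi_h_unit[OF z ij]
  by (simp add: if_distrib cong: if_cong)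

lemma h_shift_all:
  assumes z: "(x, l, h) \<in> U" "(x, l, h) \<in> cone_points"
  obtains s where "s \<noteq> 0"
    "\<And>a. (x, l, h + s *\<^sub>R axis a 1) \<in> U"
    "\<And>a. (x, l, h + s *\<^sub>R axis a 1) \<in> cone_points"
    "\<And>a i. eta i (x, l, h + s *\<^sub>R axis a 1) = eta i (x, l, h)"
    "\<And>a i. rate i (x, l, h + s *\<^sub>R axis a 1) = rate i (x, l, h)"
    "\<And>a i u. cone_tangent (x, l, h) u \<Longrightarrow>
      deta i (x, l, h + s *\<^sub>R axis a 1) u = deta i (x, l, h) u"
    "\<And>a i j. i \<noteq> j \<Longrightarrow> twist i j (x, l, h + s *\<^sub>R axis a 1) = twist i j (x, l, h)"
    "\<And>a i j. i \<noteq> j \<Longrightarrow> phi i j (x, l, h + s *\<^sub>R axis a 1) = phi i j (x, l, h) +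
      (if a = od i j then s * (twist i j (x, l, h) - rate j (x, l, h)) else 0)"
    "\<And>a i j u. i \<noteq> j \<Longrightarrow> a \<noteq> od i j \<Longrightarrow> a \<noteq> od j i \<Longrightarrow> cone_tangent (x, l, h) u \<Longrightarrow>
      dphi i j (x, l, h + s *\<^sub>R axis a 1) u = dphi i j (x, l, h) u"
proof -
  obtain e where e: "e > 0"
    "\<And>a s. \<bar>s\<bar> < e \<Longrightarrow> (x, l, h + s *\<^sub>R axis a 1) \<in> U"
    "\<And>a s. \<bar>s\<bar> < e \<Longrightarrow> (x, l, h + s *\<^sub>R axis a 1) \<in> cone_points"
    "\<And>a s i. \<bar>s\<bar> < e \<Longrightarrow> eta i (x, l, h + s *\<^sub>R axis a 1) = eta i (x, l, h)"
    "\<And>a s i. \<bar>s\<bar> < e \<Longrightarrow> rate i (x, l, h + s *\<^sub>R axis a 1) = rate i (x, l, h)"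
    "\<And>a s i u. \<bar>s\<bar> < e \<Longrightarrow> cone_tangent (x, l, h) u \<Longrightarrow>
      deta i (x, l, h + s *\<^sub>R axis a 1) u = deta i (x, l, h) u"
    "\<And>a s i j. \<bar>s\<bar> < e \<Longrightarrow> i \<noteq> j \<Longrightarrow> a \<noteq> od i j \<Longrightarrow> a \<noteq> od j i \<Longrightarrow>
      phi i j (x, l, h + s *\<^sub>R axis a 1) = phi i j (x, l, h)"
    "\<And>a s i j u. \<bar>s\<bar> < e \<Longrightarrow> i \<noteq> j \<Longrightarrow> a \<noteq> od i j \<Longrightarrow> a \<noteq> od j i \<Longrightarrow> cone_tangent (x, l, h) u \<Longrightarrow>
      dphi i j (x, l, h + s *\<^sub>R axis a 1) u = dphi i j (x, l, h) u"
    by (rule h_shift_values[OF z]) blast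
  have "\<forall>p\<in>{p :: 3 \<times> 3. fst p \<noteq> snd p}. \<exists>e>0. \<forall>s. \<bar>s\<bar> < e \<longrightarrow>
      phi (fst p) (snd p) (x, l, h + s *\<^sub>R axis (od (snd p) (fst p)) 1) = phi (fst p) (snd p) (x, l, h) \<and>
      phi (fst p) (snd p) (x, l, h + s *\<^sub>R axis (od (fst p) (snd p)) 1) = phi (fst p) (snd p) (x, l, h)
        + s * (twist (fst p) (snd p) (x, l, h) - rate (snd p) (x, l, h))"
  proof
    fix p :: "3 \<times> 3" assume "p \<in> {p. fst p \<noteq> snd p}"
    then have "fst p \<noteq> snd p" by simp
    from phi_h_shift[OF z this] show "\<exists>e>0. \<forall>s. \<bar>s\<bar> < e \<longrightarrow>
      phi (fst p) (snd p) (x, l, h + s *\<^sub>R axis (od (snd p) (fst p)) 1) = phi (fst p) (snd p) (x, l, h) \<and>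
      phi (fst p) (snd p) (x, l, h + s *\<^sub>R axis (od (fst p) (snd p)) 1) = phi (fst p) (snd p) (x, l, h)
        + s * (twist (fst p) (snd p) (x, l, h) - rate (snd p) (x, l, h))" by metis
  qed
  from bchoice[OF this] obtain E where E: "\<And>i j. i \<noteq> j \<Longrightarrow> E (i, j) > 0"
    "\<And>i j s. i \<noteq> j \<Longrightarrow> \<bar>s\<bar> < E (i, j) \<Longrightarrow>
      phi i j (x, l, h + s *\<^sub>R axis (od j i) 1) = phi i j (x, l, h) \<and>
      phi i j (x, l, h + s *\<^sub>R axis (od i j) 1) = phi i j (x, l, h)
        + s * (twist i j (x, l, h) - rate j (x, l, h))"
    by force
  \<comment> \<open>One shift must suit all six ordered pairs, whence a minimum over a finite set;
    halving makes the inequalities strict.\<close>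
  define s where "s = Min (insert e (E ` {p. fst p \<noteq> snd p})) / 2"
  have fin: "finite (insert e (E ` {p. fst p \<noteq> snd p}))" by simp
  have "Min (insert e (E ` {p. fst p \<noteq> snd p})) > 0"
    using e(1) E(1) by (subst Min_gr_iff[OF fin]) auto
  moreover have "Min (insert e (E ` {p. fst p \<noteq> snd p})) \<le> e" using fin by (intro Min_le) auto
  moreover have "Min (insert e (E ` {p. fst p \<noteq> snd p})) \<le> E (i, j)" if "i \<noteq> j" for i j
    using that fin by (intro Min_le) auto
  ultimately have s: "s > 0" "s < e" "\<And>i j. i \<noteq> j \<Longrightarrow> s < E (i, j)"
    unfolding s_def by (simp_all, smt (verit), smt (verit))
  then have s: "s > 0" "\<bar>s\<bar> < e" "\<And>i j. i \<noteq> j \<Longrightarrow> \<bar>s\<bar> < E (i, j)" by auto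
  show thesis
  proof (rule that[of s])
    show "s \<noteq> 0" using s by simp
    fix a
    show "(x, l, h + s *\<^sub>R axis a 1) \<in> U" "(x, l, h + s *\<^sub>R axis a 1) \<in> cone_points"
      using e(2,3)[OF s(2)] by auto
    show "eta i (x, l, h + s *\<^sub>R axis a 1) = eta i (x, l, h)"
        "rate i (x, l, h + s *\<^sub>R axis a 1) = rate i (x, l, h)" for i
      using e(4,5)[OF s(2)] by auto
    show "deta i (x, l, h + s *\<^sub>R axis a 1) u = deta i (x, l, h) u" if "cone_tangent (x, l, h) u" for i u
      using e(6)[OF s(2) that] by auto
    show "twist i j (x, l, h + s *\<^sub>R axis a 1) = twist i j (x, l, h)" if "i \<noteq> j" for i j
      using e(4)[OF s(2)] e(6)[OF s(2) cone_tangent_cone_rot[OF that]] by (simp add: twist_def)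
    show "dphi i j (x, l, h + s *\<^sub>R axis a 1) u = dphi i j (x, l, h) u"
      if "i \<noteq> j" "a \<noteq> od i j" "a \<noteq> od j i" "cone_tangent (x, l, h) u" for i j u
      using e(8)[OF s(2) that] by auto
    show "phi i j (x, l, h + s *\<^sub>R axis a 1) = phi i j (x, l, h) +
      (if a = od i j then s * (twist i j (x, l, h) - rate j (x, l, h)) else 0)" if ij: "i \<noteq> j" for i j
    proof -
      consider "a = od i j" | "a = od j i" "a \<noteq> od i j" | "a \<noteq> od j i" "a \<noteq> od i j" by blast
      then show ?thesis
        by cases (use E(2)[OF ij s(3)[OF ij]] e(7)[OF s(2) ij] in auto)
    qed
  qed
qed

end

definition generator_field :: "real \<Rightarrow> real^3 \<Rightarrow> real \<Rightarrow> pt \<Rightarrow> pt" where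
  "generator_field c v r = (\<lambda>(x, l, h). (c *\<^sub>R x + v, r *\<^sub>R l, - c *\<^sub>R h))"

section \<open>The relations that force \<open>twist\<close> to vanish\<close>

context lame_generator
begin

text \<open>The entry of \<open>Q k\<close> that reaches \<open>dphi i j\<close> is the one forced
  by admissibility, so no free parameter is left.\<close>

lemma determining_h_third_twist:
  assumes z: "(x, l, h) \<in> U" "(x, l, h) \<in> cone_points" and d: "i \<noteq> j" "j \<noteq> k" "i \<noteq> k"
  defines "z \<equiv> (x, l, h)"
  shows "dphi i j z (jvec k l h 0) + (twist i j z - rate j z - rate k z) * (h$od i k * h$od k j)
    = phi i k z * h$od k j + h$od i k * phi k j z"
proof -
  obtain Q where Q: "admissible h Q" using admissible_exists by blast
  have q: "Q k $ od i j = h$od i k * h$od k j" using Q d by (auto simp: admissible_def)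
  have "dphi i j z (jvec k l h (Q k)) = dphi i j z (jvec k l h 0) + dphi i j z (0, 0, Q k)"
    using jvec_eq[of k l h "Q k"] linear_add[OF linear_dphi[OF z(1)]] by (simp add: z_def)
  then show ?thesis
    using determining_h_third[OF z d Q] dphi_vertical[OF z d(1), of "Q k"] q by (simp add: z_def algebra_simps)
qed

text \<open>Moving h_kj affects neither \<open>jvec k\<close> nor \<open>phi i k\<close>. The
  comparison thus extracts the coefficient of h_kj, an identity that contains \<open>phi i k\<close>
  undifferentiated and makes it proportional to h_ik.\<close>

lemma phi_eq_twist:
  assumes z: "(x, l, h) \<in> U" "(x, l, h) \<in> cone_points" and d: "i \<noteq> j" "j \<noteq> k" "i \<noteq> k"
  defines "z \<equiv> (x, l, h)"
  shows "phi i k z = (twist i j z - rate k z - twist k j z) * h$od i k"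
proof -
  obtain s where s: "s \<noteq> 0"
    "\<And>a. (x, l, h + s *\<^sub>R axis a 1) \<in> U"
    "\<And>a. (x, l, h + s *\<^sub>R axis a 1) \<in> cone_points"
    "\<And>a i. eta i (x, l, h + s *\<^sub>R axis a 1) = eta i (x, l, h)"
    "\<And>a i. rate i (x, l, h + s *\<^sub>R axis a 1) = rate i (x, l, h)"
    "\<And>a i u. cone_tangent (x, l, h) u \<Longrightarrow>
      deta i (x, l, h + s *\<^sub>R axis a 1) u = deta i (x, l, h) u"
    "\<And>a i j. i \<noteq> j \<Longrightarrow> twist i j (x, l, h + s *\<^sub>R axis a 1) = twist i j (x, l, h)"
    "\<And>a i j. i \<noteq> j \<Longrightarrow> phi i j (x, l, h + s *\<^sub>R axis a 1) = phi i j (x, l, h) +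
      (if a = od i j then s * (twist i j (x, l, h) - rate j (x, l, h)) else 0)"
    "\<And>a i j u. i \<noteq> j \<Longrightarrow> a \<noteq> od i j \<Longrightarrow> a \<noteq> od j i \<Longrightarrow> cone_tangent (x, l, h) u \<Longrightarrow>
      dphi i j (x, l, h + s *\<^sub>R axis a 1) u = dphi i j (x, l, h) u"
    by (rule h_shift_all[OF z]) blast
  have d': "k \<noteq> j" "k \<noteq> i" "j \<noteq> i" using d by auto
  \<comment> \<open>Compare \<open>determining_h_third_twist\<close> at \<open>h\<close> and at \<open>h\<close> shifted in the direction \<open>od k j\<close>.\<close>
  have a: "od k j \<noteq> od i j" "od k j \<noteq> od j i" "od k j \<noteq> od i k" using d by (auto simp: od_eq_iff)
  have "dphi i j z (jvec k l h 0) + (twist i j z - rate j z - rate k z) * (h$od i k * (h$od k j + s))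
    = phi i k z * (h$od k j + s) + h$od i k * (phi k j z + s * (twist k j z - rate j z))"
    using determining_h_third_twist[OF s(2,3)[of "od k j"] d]
    unfolding s(5) s(7)[OF d(1)] s(8)[OF d(3)] s(8)[OF d'(1)] s(9)[OF d(1) a(1,2) cone_tangent_jvec]
    unfolding jvec_shift[OF d'(1)]
    using d d' a(3) by (simp add: axis_od z_def)
  with determining_h_third_twist[OF z d] have "s * ((twist i j z - rate j z - rate k z) * h$od i k)
      = s * (phi i k z + h$od i k * (twist k j z - rate j z))"
    by (simp add: z_def algebra_simps)
  then have "(twist i j z - rate j z - rate k z) * h$od i k = phi i k z + h$od i k * (twist k j z - rate j z)"
    using s(1) by simp
  then show ?thesis by (simp add: algebra_simps)
qed

text \<open>The slope of \<open>phi i k\<close> in h_ik is known twice: from the formula in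
  \<open>phi_eq_twist\<close> and from the definition of \<open>twist i k\<close>.\<close>

lemma twist_cocycle:
  assumes z: "(x, l, h) \<in> U" "(x, l, h) \<in> cone_points" and d: "i \<noteq> j" "j \<noteq> k" "i \<noteq> k"
  defines "z \<equiv> (x, l, h)"
  shows "twist i k z + twist k j z = twist i j z"
proof -
  obtain s where s: "s \<noteq> 0"
    "\<And>a. (x, l, h + s *\<^sub>R axis a 1) \<in> U"
    "\<And>a. (x, l, h + s *\<^sub>R axis a 1) \<in> cone_points"
    "\<And>a i. eta i (x, l, h + s *\<^sub>R axis a 1) = eta i (x, l, h)"
    "\<And>a i. rate i (x, l, h + s *\<^sub>R axis a 1) = rate i (x, l, h)"
    "\<And>a i u. cone_tangent (x, l, h) u \<Longrightarrow>
      deta i (x, l, h + s *\<^sub>R axis a 1) u = deta i (x, l, h) u"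
    "\<And>a i j. i \<noteq> j \<Longrightarrow> twist i j (x, l, h + s *\<^sub>R axis a 1) = twist i j (x, l, h)"
    "\<And>a i j. i \<noteq> j \<Longrightarrow> phi i j (x, l, h + s *\<^sub>R axis a 1) = phi i j (x, l, h) +
      (if a = od i j then s * (twist i j (x, l, h) - rate j (x, l, h)) else 0)"
    by (rule h_shift_all[OF z]) blast
  have d': "k \<noteq> j" using d by auto
  have "phi i k z + s * (twist i k z - rate k z)
      = (twist i j z - rate k z - twist k j z) * (h$od i k + s)"
    using phi_eq_twist[OF s(2,3)[of "od i k"] d]
    unfolding s(5) s(7)[OF d(1)] s(7)[OF d'] s(8)[OF d(3)]
    using d by (simp add: axis_od z_def)
  then have "s * (twist i k z - rate k z) = s * (twist i j z - rate k z - twist k j z)"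
    using phi_eq_twist[OF z d] by (simp add: z_def algebra_simps)
  then show ?thesis using s(1) by simp
qed

text \<open>Shift h_ji in the equation for l_i,x_i. \<open>deta i\<close> responds along the
  rotation j, i, which is a multiple of the rotation i, j and so brings in \<open>twist i j\<close>;
  \<open>phi j i\<close> responds with \<open>twist j i\<close>. The terms with \<open>eta\<close>
  and \<open>rate\<close> cancel.\<close>

lemma twist_sym:
  assumes z: "(x, l, h) \<in> U" "(x, l, h) \<in> cone_points" and ij: "i \<noteq> j"
  defines "z \<equiv> (x, l, h)"
  shows "twist i j z = twist j i z"
proof -
  obtain s where s: "s \<noteq> 0"
    "\<And>a. (x, l, h + s *\<^sub>R axis a 1) \<in> U"
    "\<And>a. (x, l, h + s *\<^sub>R axis a 1) \<in> cone_points"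
    "\<And>a i. eta i (x, l, h + s *\<^sub>R axis a 1) = eta i (x, l, h)"
    "\<And>a i. rate i (x, l, h + s *\<^sub>R axis a 1) = rate i (x, l, h)"
    "\<And>a i u. cone_tangent (x, l, h) u \<Longrightarrow>
      deta i (x, l, h + s *\<^sub>R axis a 1) u = deta i (x, l, h) u"
    "\<And>a i j. i \<noteq> j \<Longrightarrow> twist i j (x, l, h + s *\<^sub>R axis a 1) = twist i j (x, l, h)"
    "\<And>a i j. i \<noteq> j \<Longrightarrow> phi i j (x, l, h + s *\<^sub>R axis a 1) = phi i j (x, l, h) +
      (if a = od i j then s * (twist i j (x, l, h) - rate j (x, l, h)) else 0)"
    by (rule h_shift_all[OF z]) blast
  obtain k where k: "j \<noteq> k" "i \<noteq> k" using obtain_third[OF ij] by blast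
  note d = ij k
  have d': "k \<noteq> j" "k \<noteq> i" "j \<noteq> i" using d by auto
  have lj: "l$j \<noteq> 0" using l_nonzero[OF z(2)] .
  have a: "od j i \<noteq> od k i" using d by (auto simp: od_eq_iff)
  have cone_rot: "deta i z (cone_rot j i l) = - (eps j * eps i) * (twist i j z * l$j + eta j z)"
    unfolding cone_rot_antisym[of j i]
    using lj by (simp add: linear_scale linear_neg linear_deta[OF z(1)] twist_def z_def)
  have "deta i z (jvec i l h 0 + s *\<^sub>R cone_rot j i l)
      = deta i z (jvec i l h 0) - s * (eps j * eps i) * (twist i j z * l$j + eta j z)"
  proof -
    have "deta i z (jvec i l h 0 + s *\<^sub>R cone_rot j i l) = deta i z (jvec i l h 0) + s * deta i z (cone_rot j i l)"
      by (simp add: linear_add linear_scale linear_deta[OF z(1)] z_def)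
    then show ?thesis unfolding cone_rot by (simp add: algebra_simps)
  qed
  moreover have "pcol l (h + s *\<^sub>R axis (od j i) 1) i $ i = pcol l h i $ i - eps i * eps j * s * l$j"
    using d d' by (simp add: pcol_diag[OF d] axis_od algebra_simps)
  moreover have "eps i * (deta i z (jvec i l h 0 + s *\<^sub>R cone_rot j i l) - rate i z * pcol l (h + s *\<^sub>R axis (od j i) 1) i $ i)
      + eps j * ((phi j i z + s * (twist j i z - rate i z)) * l$j + (h$od j i + s) * eta j z)
      + eps k * (phi k i z * l$k + h$od k i * eta k z) = 0"
    using determining_l_diag[OF s(2,3)[of "od j i"] d]
    unfolding s(4,5) s(8)[OF d'(3)] s(8)[OF d'(2)] s(6)[OF cone_tangent_jvec]
    unfolding jvec_shift[OF d'(3)]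
    using d d' a by (simp add: axis_od z_def)
  ultimately have shifted: "eps i * ((deta i z (jvec i l h 0) - s * (eps j * eps i) * (twist i j z * l$j + eta j z))
        - rate i z * (pcol l h i $ i - eps i * eps j * s * l$j))
      + eps j * ((phi j i z + s * (twist j i z - rate i z)) * l$j + (h$od j i + s) * eta j z)
      + eps k * (phi k i z * l$k + h$od k i * eta k z) = 0" by metis
  have "eps j * s * l$j * (twist j i z - twist i j z)
    = (eps i * ((deta i z (jvec i l h 0) - s * (eps j * eps i) * (twist i j z * l$j + eta j z))
        - rate i z * (pcol l h i $ i - eps i * eps j * s * l$j))
      + eps j * ((phi j i z + s * (twist j i z - rate i z)) * l$j + (h$od j i + s) * eta j z)
      + eps k * (phi k i z * l$k + h$od k i * eta k z))
    - (eps i * (deta i z (jvec i l h 0) - rate i z * pcol l h i $ i)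
      + eps j * (phi j i z * l$j + h$od j i * eta j z)
      + eps k * (phi k i z * l$k + h$od k i * eta k z))"
    by (simp add: algebra_simps)
  also have "\<dots> = 0" unfolding shifted using determining_l_diag[OF z d] by (simp add: z_def)
  finally have "eps j * s * l$j * (twist j i z - twist i j z) = 0" .
  then show ?thesis using s(1) lj by simp
qed

text \<open>Adding the cocycle identity to the one with j and k exchanged gives twist j k + twist k
  j = 0.\<close>

lemma twist_zero:
  assumes z: "(x, l, h) \<in> U" "(x, l, h) \<in> cone_points" and jk: "j \<noteq> k"
  shows "twist j k (x, l, h) = 0"
proof -
  obtain i where i: "k \<noteq> i" "j \<noteq> i" using obtain_third[OF jk] by blast
  then have d: "i \<noteq> j" "j \<noteq> k" "i \<noteq> k" "k \<noteq> j" using jk by auto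
  show ?thesis
    using twist_cocycle[OF z d(1,2,3)] twist_cocycle[OF z d(3,4,1)] twist_sym[OF z jk] by simp
qed

section \<open>Consequences of the vanishing of \<open>twist\<close>\<close>

lemma phi_eq:
  assumes z: "(x, l, h) \<in> U" "(x, l, h) \<in> cone_points" and ik: "i \<noteq> k"
  shows "phi i k (x, l, h) = - rate k (x, l, h) * h$od i k"
proof -
  obtain j where j: "k \<noteq> j" "i \<noteq> j" using obtain_third[OF ik] by blast
  then have d: "i \<noteq> j" "j \<noteq> k" "i \<noteq> k" "k \<noteq> j" using ik by auto
  show ?thesis
    using phi_eq_twist[OF z d(1,2,3)] twist_zero[OF z d(1)] twist_zero[OF z d(4)] by simp
qed

lemma deta_cone_rot:
  assumes z: "(x, l, h) \<in> U" "(x, l, h) \<in> cone_points" and ij: "i \<noteq> j"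
  shows "deta i (x, l, h) (cone_rot i j l) = eta j (x, l, h)"
  using twist_zero[OF z ij] l_nonzero[OF z(2), of j] by (simp add: twist_def)

text \<open>Apply \<open>deta i\<close> to the cyclic relation between the rotations: the right-hand
  side vanishes, and the two terms on the left yield \<open>eta j\<close> and
  \<open>eta k\<close>.\<close>

lemma eta_proportional:
  assumes z: "(x, l, h) \<in> U" "(x, l, h) \<in> cone_points"
  shows "eta j (x, l, h) / l$j = eta k (x, l, h) / l$k"
proof (cases "j = k")
  case False
  then obtain i where i: "k \<noteq> i" "j \<noteq> i" using obtain_third[OF False] by blast
  then have d: "i \<noteq> j" "j \<noteq> k" "i \<noteq> k" using False by auto
  have "deta i (x, l, h) (l$k *\<^sub>R cone_rot i j l - l$j *\<^sub>R cone_rot i k l) = 0"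
    unfolding cone_rot_cyclic using deta_cone_rot_third[OF z d]
    by (simp add: linear_scale linear_deta[OF z(1)])
  then have "l$k * eta j (x, l, h) = l$j * eta k (x, l, h)"
    using deta_cone_rot[OF z d(1)] deta_cone_rot[OF z d(3)]
    by (simp add: linear_diff linear_scale linear_deta[OF z(1)])
  then show ?thesis using l_nonzero[OF z(2), of j] l_nonzero[OF z(2), of k] by (simp add: field_simps)
qed simp

text \<open>In the equation for l_i,x_j the terms with \<open>rate\<close> and \<open>phi\<close>
  now cancel, and h_ij times \<open>eta j\<close> is exactly the contribution of the rotation i,
  j.\<close>

lemma deta_x_unit:
  assumes z: "(x, l, h) \<in> U" "(x, l, h) \<in> cone_points" and ij: "i \<noteq> j"
  shows "deta i (x, l, h) (x_unit j) = 0"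
proof -
  obtain k where k: "j \<noteq> k" "i \<noteq> k" using obtain_third[OF ij] by blast
  then have d: "i \<noteq> k" "k \<noteq> j" "i \<noteq> j" using ij by auto
  show ?thesis
    using determining_l_offdiag[OF z ij k] deta_cone_rot[OF z ij] deta_cone_rot_third[OF z ij k] phi_eq[OF z ij] deta_vertical[OF z]
    unfolding jvec_decomp[OF d]
    by (simp add: linear_add linear_scale linear_deta[OF z(1)])
qed

text \<open>Raise the derivative of h_ij in x_j by 1 and lower that of h_ji in x_i by 1. The skew
  equation then changes by 2 (rate i - rate j): half comes from \<open>dphi\<close>, half from the
  prolongation terms.\<close>

lemma rate_eq:
  assumes z: "(x, l, h) \<in> U" "(x, l, h) \<in> cone_points"
  shows "rate i (x, l, h) = rate j (x, l, h)"
proof (cases "i = j")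
  case False
  obtain k where k: "j \<noteq> k" "i \<noteq> k" using obtain_third[OF False] by blast
  note d = False k
  have ji: "j \<noteq> i" using d by auto
  obtain Q where Q: "admissible h Q" using admissible_exists by blast
  let ?z = "(x, l, h)"
  have j: "dphi i j ?z (jvec j l h (Q j + axis (od i j) 1)) = dphi i j ?z (jvec j l h (Q j)) - rate j ?z"
    unfolding jvec_add using dphi_vertical[OF z False] twist_zero[OF z False] False
    by (simp add: linear_add linear_dphi[OF z(1)] axis_od)
  have i: "dphi j i ?z (jvec i l h (Q i - axis (od j i) 1)) = dphi j i ?z (jvec i l h (Q i)) + rate i ?z"
    using jvec_add[of i l h "Q i" "- axis (od j i) 1"] dphi_vertical[OF z ji] twist_zero[OF z ji] ji
    by (simp add: linear_add linear_dphi[OF z(1)] axis_od)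
  show ?thesis
    using determining_h_skew[OF z d Q] determining_h_skew[OF z d admissible_perturb1[OF Q ji, of 1]] i j ji False
    by (simp add: axis_od algebra_simps)
qed simp

lemma dxi_tangent:
  assumes z: "z \<in> U" "z \<in> cone_points" and u: "cone_tangent z u"
  shows "dxi i z u = rate 1 z * fst u $ i"
proof -
  obtain x l h where zz: "z = (x, l, h)" by (cases z)
  obtain dx dl dh where uu: "u = (dx, dl, dh)" by (cases u)
  obtain n m k where d: "n \<noteq> m" "m \<noteq> k" "n \<noteq> (k :: 3)"
    by (metis obtain_third zero_neq_one)
  note z' = z[unfolded zz]
  note L = linear_dxi[OF z'(1), of i]
  have "dxi i (x, l, h) (dx, dl, dh) = (\<Sum>j\<in>UNIV. dx$j * dxi i (x, l, h) (x_unit j))"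
    unfolding cone_tangent_decomp[OF d l_nonzero[OF z'(2)] u[unfolded zz uu]]
    using dxi_cone_rot[OF z' d(2)] dxi_cone_rot[OF z' d(3)] dxi_vertical[OF z']
    by (simp add: linear_add[OF L] linear_scale[OF L] linear_sum[OF L])
  also have "\<dots> = dx$i * rate i (x, l, h)"
    unfolding dxi_x_unit[OF z'] by (simp add: if_distrib cong: if_cong)
  finally show ?thesis using rate_eq[OF z', of i 1] by (simp add: zz uu)
qed

definition ratio where "ratio i z = eta i z / fst (snd z) $ i"
definition dratio where
  "dratio i z u = (deta i z u * fst (snd z) $ i - eta i z * fst (snd u) $ i) / (fst (snd z) $ i)\<^sup>2"

lemma has_derivative_ratio:
  assumes "z \<in> U" "z \<in> cone_points"
  shows "(ratio i has_derivative dratio i z) (at z)"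
proof -
  have "fst (snd z) $ i \<noteq> 0" using assms(2) l_nonzero by (cases z) auto
  moreover have "((\<lambda>z. fst (snd z) $ i) has_derivative (\<lambda>u. fst (snd u) $ i)) (at z)"
    by (intro bounded_linear.has_derivative[OF bounded_linear_vec_nth] has_derivative_fst
        has_derivative_snd has_derivative_ident)
  ultimately have "((\<lambda>z. eta i z / fst (snd z) $ i) has_derivative (\<lambda>u.
      (deta i z u * fst (snd z) $ i - eta i z * fst (snd u) $ i) / (fst (snd z) $ i * fst (snd z) $ i))) (at z)"
    using has_derivative_divide'[OF has_derivative_eta[OF assms(1)]] by blast
  then show ?thesis by (simp add: ratio_def[abs_def] dratio_def[abs_def] power2_eq_square)
qed

text \<open>The ratios \<open>\<eta>\<^sub>i / l\<^sub>i\<close> agree on the cone, and in each basic direction one of them visibly has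
  derivative zero.\<close>

lemma dratio_tangent:
  assumes z: "z \<in> U" "z \<in> cone_points" and u: "cone_tangent z u"
  shows "dratio i z u = 0"
proof -
  obtain x l h where zz: "z = (x, l, h)" by (cases z)
  obtain dx dl dh where uu: "u = (dx, dl, dh)" by (cases u)
  note z' = z[unfolded zz]
  \<comment> \<open>The ratios agree on the cone only, so only their tangential derivatives can be
    identified.\<close>
  have same: "dratio i z v = dratio j z v" if v: "cone_tangent z v" for i j v
  proof -
    obtain e where e: "e > (0::real)" "\<And>(f :: pt \<Rightarrow> real) f' u. (f has_derivative f') (at z) \<Longrightarrow>
      (\<And>z. z \<in> U \<inter> cone_points \<Longrightarrow> f z = 0) \<Longrightarrow> cone_tangent z u \<Longrightarrow> f' u = 0"
      by (rule cone_transport[OF open_U U_variable z]) blast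
    have "(\<lambda>u. dratio i z u - dratio j z u) v = 0"
    proof (rule e(2)[OF _ _ v])
      show "((\<lambda>w. ratio i w - ratio j w) has_derivative (\<lambda>u. dratio i z u - dratio j z u)) (at z)"
        by (intro has_derivative_diff has_derivative_ratio z)
      show "ratio i w - ratio j w = 0" if "w \<in> U \<inter> cone_points" for w
        using that eta_proportional by (cases w) (auto simp: ratio_def)
    qed
    then show ?thesis by simp
  qed
  have L: "linear (dratio i z)" using has_derivative_ratio[OF z] has_derivative_linear by blast
  have E: "dratio i z (x_unit j) = 0" for j
  proof -
    obtain n where "n \<noteq> j" by (metis zero_neq_one)
    then have "dratio n z (x_unit j) = 0" using deta_x_unit[OF z'] by (simp add: dratio_def zz x_unit_def)
    then show ?thesis using same[OF cone_tangent_x_unit] by metis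
  qed
  have R: "dratio i z (cone_rot n k l) = 0" if nk: "n \<noteq> k" for n k
  proof -
    obtain m where m: "k \<noteq> m" "n \<noteq> m" using obtain_third[OF nk] by blast
    then have d: "m \<noteq> k" "k \<noteq> n" "m \<noteq> n" using nk by auto
    have "dratio m z (cone_rot n k l) = 0"
      using deta_cone_rot_third[OF z' d] d by (simp add: dratio_def zz cone_rot_def axis_def)
    then show ?thesis using same cone_tangent_cone_rot[OF nk] by (metis zz)
  qed
  have W: "dratio i z (0, 0, w) = 0" for w
    using deta_vertical[OF z] by (simp add: dratio_def)
  obtain n m k where d: "n \<noteq> m" "m \<noteq> k" "n \<noteq> (k :: 3)"
    by (metis obtain_third zero_neq_one)
  show ?thesis
    unfolding uu cone_tangent_decomp[OF d l_nonzero[OF z'(2)] u[unfolded zz uu]]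
    by (simp add: linear_add[OF L] linear_scale[OF L] linear_sum[OF L] E R[OF d(2)] R[OF d(3)] W)
qed

lemma generator_local_form:
  assumes z0: "z0 \<in> U" "z0 \<in> cone_points"
  obtains e c v r where "e > 0" "ball z0 e \<subseteq> U"
    "\<And>z. z \<in> ball z0 e \<Longrightarrow> z \<in> cone_points \<Longrightarrow> V z = generator_field c v r z"
proof -
  obtain e where e: "e > 0" "ball z0 e \<subseteq> U"
    "\<And>(f :: pt \<Rightarrow> real) f' c i y z. (\<And>z. z \<in> U \<inter> cone_points \<Longrightarrow> (f has_derivative f' z) (at z)) \<Longrightarrow>
      (\<And>z u. z \<in> U \<inter> cone_points \<Longrightarrow> cone_tangent z u \<Longrightarrow> f' z u = c z * fst u $ i) \<Longrightarrow>
      y \<in> ball z0 e \<Longrightarrow> y \<in> cone_points \<Longrightarrow> z \<in> ball z0 e \<Longrightarrow> z \<in> cone_points \<Longrightarrow>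
      fst y $ i = fst z $ i \<Longrightarrow> c y = c z"
    by (rule cone_transport[OF open_U U_variable z0]) blast
  have same: "rate 1 y = rate 1 z" if "y \<in> ball z0 e" "y \<in> cone_points" "z \<in> ball z0 e" "z \<in> cone_points"
    "fst y $ i = fst z $ i" for y z i
    by (rule e(3)[of "xi i" "dxi i"])
      (use that in \<open>auto intro: has_derivative_xi dxi_tangent\<close>)
  \<comment> \<open>Half the radius: the intermediate point \<open>y'\<close> is at distance less
    than e/2 from y and so remains in the ball.\<close>
  have rate: "rate 1 y = rate 1 z0" if y: "y \<in> ball z0 (e/2)" "y \<in> cone_points" for y
  proof -
    define t where "t = fst z0 $ 1 - fst y $ 1"
    \<comment> \<open>The common rate depends on \<open>x\<^sub>1\<close> only, but also on \<open>x\<^sub>2\<close> only; \<open>y'\<close> shares \<open>x\<^sub>1\<close> with \<open>z0\<close> and \<open>x\<^sub>2\<close> with \<open>y\<close>.\<close>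
    define y' where "y' = y + (t *\<^sub>R axis 1 1, 0, 0)"
    have "\<bar>t\<bar> \<le> norm (fst (z0 - y))" unfolding t_def
      using component_le_norm_cart[of "fst (z0 - y)" 1] by simp
    also have "\<dots> \<le> norm (z0 - y)" by (metis norm_fst_le prod.collapse)
    finally have t: "\<bar>t\<bar> < e/2" using y(1) by (simp add: dist_norm)
    have "dist y' y = \<bar>t\<bar>" by (simp add: y'_def dist_norm norm_Pair)
    then have yb: "y' \<in> ball z0 e" using y(1) t dist_triangle[of z0 y' y] by (simp add: dist_commute)
    have yb0: "y \<in> ball z0 e" using y(1) zero_le_dist[of z0 y] unfolding mem_ball by linarith
    have yc: "y' \<in> cone_points"
      using y(2) by (auto simp: y'_def cone_points_def variable_space_def split_beta)
    have "rate 1 y' = rate 1 z0"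
      by (rule same[OF yb yc _ z0(2), of 1]) (use e(1) in \<open>auto simp: y'_def t_def\<close>)
    moreover have "rate 1 y = rate 1 y'"
      by (rule same[OF _ y(2) yb yc, of 2]) (use yb0 in \<open>simp_all add: y'_def axis_def\<close>)
    ultimately show ?thesis by simp
  qed
  \<comment> \<open>\<open>cone_transport\<close> is applied once more with \<open>B\<close> in
    place of \<open>U\<close>: the rate is known to be constant on \<open>B\<close> only, and there
    xi_i - c x_i has zero tangential derivative.\<close>
  define B where "B = ball z0 (e/2)"
  have B: "open B" "B \<subseteq> U" "z0 \<in> B" using e(1,2) by (auto simp: B_def)
  have BV: "B \<subseteq> variable_space" using B(2) U_variable by blast
  obtain e' where e': "e' > 0" "ball z0 e' \<subseteq> B"
    "\<And>(f :: pt \<Rightarrow> real) f' y. (\<And>z. z \<in> B \<inter> cone_points \<Longrightarrow> (f has_derivative f' z) (at z)) \<Longrightarrow>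
      (\<And>z u. z \<in> B \<inter> cone_points \<Longrightarrow> cone_tangent z u \<Longrightarrow> f' z u = 0) \<Longrightarrow>
      y \<in> ball z0 e' \<Longrightarrow> y \<in> cone_points \<Longrightarrow> f y = f z0"
    by (rule cone_transport[OF B(1) BV B(3) z0(2)]) blast
  define c where "c = rate 1 z0"
  define v :: "real^3" where "v = (\<chi> i. xi i z0 - c * fst z0 $ i)"
  define r where "r = ratio 1 z0"
  show thesis
  proof (rule that[of e' c v r])
    show "e' > 0" "ball z0 e' \<subseteq> U" using e'(1,2) B(2) by auto
    fix z assume z: "z \<in> ball z0 e'" "z \<in> cone_points"
    then have zB: "z \<in> B" and zU: "z \<in> U" using e'(2) B(2) by auto
    obtain x l h where zz: "z = (x, l, h)" by (cases z)
    note z' = zU[unfolded zz] z(2)[unfolded zz]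
    have rz: "rate i z = c" for i
      using rate_eq[OF z', of i 1] rate[of z] zB z(2) by (simp add: c_def B_def zz)
    have "xi i z - c * fst z $ i = xi i z0 - c * fst z0 $ i" for i
    proof (rule e'(3)[OF _ _ z, of "\<lambda>z. xi i z - c * fst z $ i" "\<lambda>z u. dxi i z u - c * fst u $ i"])
      fix w assume w: "w \<in> B \<inter> cone_points"
      have "((\<lambda>z. c * fst z $ i) has_derivative (\<lambda>u. c * fst u $ i)) (at w)"
        by (intro has_derivative_mult_right bounded_linear.has_derivative[OF bounded_linear_vec_nth]
            has_derivative_fst has_derivative_ident)
      then show "((\<lambda>z. xi i z - c * fst z $ i) has_derivative (\<lambda>u. dxi i w u - c * fst u $ i)) (at w)"
        using w B(2) by (intro has_derivative_diff has_derivative_xi) auto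
      show "dxi i w u - c * fst u $ i = 0" if "cone_tangent w u" for u
        using dxi_tangent[of w u i] that w B(2) rate[of w] by (auto simp: c_def B_def)
    qed
    then have 1: "fst (V z) = c *\<^sub>R x + v"
      by (simp add: vec_eq_iff v_def zz xi_def algebra_simps)
    have "ratio 1 z = r" unfolding r_def
      by (rule e'(3)[OF _ _ z, of "ratio 1" "dratio 1"])
        (use B(2) in \<open>auto intro: has_derivative_ratio dratio_tangent\<close>)
    then have "eta i z / l$i = r" for i
      using eta_proportional[OF z', of i 1] by (simp add: ratio_def zz)
    then have "eta i z = r * l$i" for i using l_nonzero[OF z'(2), of i] by (metis nonzero_eq_divide_eq)
    then have 2: "fst (snd (V z)) = r *\<^sub>R l" by (simp add: vec_eq_iff eta_def)
    have "snd (snd (V z)) $ a = - c * h $ a" for a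
    proof -
      obtain i j where a: "a = od i j" "i \<noteq> j" by (rule offdiag_cases)
      show ?thesis using phi_eq[OF z' a(2)] rz[of j] by (simp add: phi_def a(1) zz)
    qed
    then have 3: "snd (snd (V z)) = - c *\<^sub>R h" by (simp add: vec_eq_iff)
    show "V z = generator_field c v r z"
      using 1 2 3 by (simp add: generator_field_def zz prod_eq_iff)
  qed
qed

end

section \<open>Exponentials of the generators\<close>

lemma smooth_locally_lipschitz:
  fixes V :: "'a::euclidean_space \<Rightarrow> 'b::real_normed_vector"
  assumes V: "smooth_on_open V U" and z: "z \<in> U"
  obtains d L where "d > 0" "L \<ge> 0" "ball z d \<subseteq> U"
    "\<And>x y. x \<in> ball z d \<Longrightarrow> y \<in> ball z d \<Longrightarrow> norm (V x - V y) \<le> L * norm (x - y)"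
proof -
  have "Ck_on (Suc 0) V U" using V by (auto simp only: smooth_on_open_def)
  then obtain V' where V': "\<And>x. x \<in> U \<Longrightarrow> (V has_derivative V' x) (at x)"
    "\<And>v. continuous_on U (\<lambda>x. V' x v)" by auto
  obtain d where d: "d > 0" "cball z d \<subseteq> U"
    using V z by (auto simp: smooth_on_open_def open_contains_cball)
  have "\<exists>K. \<forall>x\<in>cball z d. norm (V' x b) \<le> K" for b
  proof -
    have "compact ((\<lambda>x. V' x b) ` cball z d)"
      by (intro compact_continuous_image continuous_on_subset[OF V'(2) d(2)] compact_cball)
    from compact_imp_bounded[OF this] show ?thesis unfolding bounded_iff by blast
  qed
  then obtain K where K: "\<And>b x. x \<in> cball z d \<Longrightarrow> norm (V' x b) \<le> K b" by metis
  \<comment> \<open>\<open>Ck_on\<close> gives continuity of the derivative for each fixed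
    direction; compactness bounds it on the basis vectors, and the sum of these bounds controls all
    directions.\<close>
  define L where "L = (\<Sum>b\<in>Basis. K b)"
  have K0: "K b \<ge> 0" for b using K[of z b] d(1) norm_ge_zero order_trans by (metis centre_in_cball less_eq_real_def)
  have bound: "norm (V' x u) \<le> L * norm u" if x: "x \<in> cball z d" for x u
  proof -
    have lin: "linear (V' x)" using V'(1) x d(2) has_derivative_linear by blast
    have "V' x u = V' x (\<Sum>b\<in>Basis. (u \<bullet> b) *\<^sub>R b)" by (simp add: euclidean_representation)
    also have "\<dots> = (\<Sum>b\<in>Basis. (u \<bullet> b) *\<^sub>R V' x b)" by (simp add: linear_sum[OF lin] linear_scale[OF lin])
    finally have "norm (V' x u) \<le> (\<Sum>b\<in>Basis. norm ((u \<bullet> b) *\<^sub>R V' x b))" by (simp add: sum_norm_le)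
    also have "\<dots> \<le> (\<Sum>b\<in>Basis. norm u * K b)"
      by (intro sum_mono) (auto intro!: mult_mono K[OF x] K0 Basis_le_norm)
    finally show ?thesis by (simp add: L_def sum_distrib_left mult.commute)
  qed
  have "norm (V x - V y) \<le> L * norm (x - y)" if "x \<in> ball z d" "y \<in> ball z d" for x y
  proof (rule differentiable_bound[OF convex_ball _ _ that])
    show "(V has_derivative V' w) (at w within ball z d)" if "w \<in> ball z d" for w
      using V'(1)[of w] that d(2) has_derivative_at_withinI by (meson ball_subset_cball subsetD)
    show "onorm (V' w) \<le> L" if "w \<in> ball z d" for w
      using that K0 bound[of w] by (intro onorm_bound) (auto simp: L_def intro!: sum_nonneg)
  qed
  moreover have "L \<ge> 0" using K0 by (simp add: L_def sum_nonneg)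
  ultimately show thesis using that[of d L] d by (meson ball_subset_cball subset_trans)
qed

text \<open>On so short an interval, the mean value inequality bounds the maximum of |f - g| by half
  of itself.\<close>

lemma ode_unique_short:
  fixes V :: "'a::real_normed_vector \<Rightarrow> 'a"
  assumes ab: "a \<le> b" and L: "L \<ge> 0" "L * (b - a) \<le> 1 / 2"
    and lip: "\<And>x y. x \<in> S \<Longrightarrow> y \<in> S \<Longrightarrow> norm (V x - V y) \<le> L * norm (x - y)"
    and f: "\<And>s. s \<in> {a..b} \<Longrightarrow> f s \<in> S \<and> (f has_vector_derivative V (f s)) (at s within {a..b})"
    and g: "\<And>s. s \<in> {a..b} \<Longrightarrow> g s \<in> S \<and> (g has_vector_derivative V (g s)) (at s within {a..b})"
    and init: "f a = g a" and s: "s \<in> {a..b}"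
  shows "f s = g s"
proof -
  define D where "D s = f s - g s" for s
  have D: "(D has_vector_derivative (V (f s) - V (g s))) (at s within {a..b})" if "s \<in> {a..b}" for s
    unfolding D_def[abs_def] using f[OF that] g[OF that] by (auto intro!: derivative_intros)
  then have "continuous_on {a..b} D" by (rule continuous_on_vector_derivative)
  then have "continuous_on {a..b} (\<lambda>s. norm (D s))" by (rule continuous_on_norm)
  then obtain m where m: "m \<in> {a..b}" "\<And>s. s \<in> {a..b} \<Longrightarrow> norm (D s) \<le> norm (D m)"
    using continuous_attains_sup[of "{a..b}" "\<lambda>s. norm (D s)"] ab by auto
  have "norm (D m - D a) \<le> (L * norm (D m)) * norm (m - a)"
  proof (rule differentiable_bound[OF _ _ _ m(1)])
    show "(D has_derivative (\<lambda>h. h *\<^sub>R (V (f s) - V (g s)))) (at s within {a..b})" if "s \<in> {a..b}" for s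
      using D[OF that] by (simp add: has_vector_derivative_def)
    show "onorm (\<lambda>h. h *\<^sub>R (V (f s) - V (g s))) \<le> L * norm (D m)" if s: "s \<in> {a..b}" for s
    proof (rule onorm_le)
      fix h :: real
      have "norm (V (f s) - V (g s)) \<le> L * norm (D s)" using lip f[OF s] g[OF s] by (simp add: D_def)
      also have "\<dots> \<le> L * norm (D m)" using m(2)[OF s] L(1) by (intro mult_left_mono)
      finally show "norm (h *\<^sub>R (V (f s) - V (g s))) \<le> L * norm (D m) * norm h"
        by (simp add: mult.commute mult_left_mono)
    qed
  qed (use ab in auto)
  also have "\<dots> \<le> (L * norm (D m)) * (b - a)" using m(1) L(1) by (intro mult_left_mono) auto
  also have "\<dots> = (L * (b - a)) * norm (D m)" by simp
  also have "\<dots> \<le> 1 / 2 * norm (D m)" using L(2) by (intro mult_right_mono) auto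
  finally have "norm (D m) \<le> 0" using init by (simp add: D_def)
  then have "norm (D s) \<le> 0" using m(2)[OF s] by simp
  then show ?thesis by (simp add: D_def)
qed

text \<open>The curve \<open>g\<close> is known to solve the equation only as long as it has not left \<open>U\<close>.\<close>

lemma ode_continuation:
  fixes V :: "'a::euclidean_space \<Rightarrow> 'a"
  assumes V: "smooth_on_open V U"
    and f: "\<And>s. s \<in> {0..1} \<Longrightarrow> f s \<in> U \<and> (f has_vector_derivative t *\<^sub>R V (f s)) (at s within {0..1})"
    and g: "continuous_on {0..1} g"
    and gK: "\<And>b s. b \<in> {0..1} \<Longrightarrow> g ` {0..b} \<subseteq> U \<Longrightarrow> s \<in> {0..b} \<Longrightarrow>
      (g has_vector_derivative t *\<^sub>R V (g s)) (at s within {0..1})"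
    and init: "f 0 = g 0" and s: "s \<in> {0..1}"
  shows "f s = g s"
proof (rule ccontr)
  assume "f s \<noteq> g s"
  define A where "A = {s \<in> {0..1}. f s \<noteq> g s}"
  have A: "A \<noteq> {}" "bdd_below A" using s \<open>f s \<noteq> g s\<close> by (auto simp: A_def bdd_below_def)
  define b where "b = Inf A"
  have b01: "b \<in> {0..1}"
  proof -
    have "b \<le> s" using s \<open>f s \<noteq> g s\<close> A(2) by (auto simp: b_def A_def intro!: cInf_lower)
    moreover have "b \<ge> 0" unfolding b_def using A(1) by (intro cInf_greatest) (auto simp: A_def)
    ultimately show ?thesis using s by auto
  qed
  have below: "f u = g u" if "u \<in> {0..<b}" for u
    using that b01 cInf_lower[OF _ A(2), of u] by (force simp: A_def b_def)
  have fc: "continuous_on {0..1} f"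
    by (rule continuous_on_vector_derivative) (use f in blast)
  have at_b: "f b = g b"
  proof (cases "b = 0")
    case False
    then have b0: "b > 0" using b01 by auto
    have "((\<lambda>u. f u - g u) \<longlongrightarrow> f b - g b) (at b within {0..<b})"
    proof (rule tendsto_within_subset)
      show "((\<lambda>u. f u - g u) \<longlongrightarrow> f b - g b) (at b within {0..1})"
        using continuous_on_diff[OF fc g] b01 by (auto simp: continuous_on_def)
    qed (use b01 in auto)
    moreover have "((\<lambda>u. f u - g u) \<longlongrightarrow> 0) (at b within {0..<b})"
      by (rule tendsto_eventually) (use below in \<open>auto simp: eventually_at_filter\<close>)
    moreover have "at b within {0..<b} \<noteq> bot"
      using b0 by (simp add: trivial_limit_within islimpt_Ico)
    ultimately have "f b - g b = 0" using tendsto_unique by blast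
    then show ?thesis by simp
  qed (use init in simp)
  have fbU: "f b \<in> U" using f b01 by blast
  obtain d L where dL: "d > 0" "L \<ge> 0" "ball (f b) d \<subseteq> U"
    "\<And>x y. x \<in> ball (f b) d \<Longrightarrow> y \<in> ball (f b) d \<Longrightarrow> norm (V x - V y) \<le> L * norm (x - y)"
    using smooth_locally_lipschitz[OF V fbU] by metis
  have "\<exists>e>0. \<forall>u\<in>{0..1}. dist u b < e \<longrightarrow> dist (f u) (f b) < d"
    using fc b01 dL(1) by (auto simp: continuous_on_iff)
  moreover have "\<exists>e>0. \<forall>u\<in>{0..1}. dist u b < e \<longrightarrow> dist (g u) (g b) < d"
    using g b01 dL(1) by (auto simp: continuous_on_iff)
  ultimately obtain e1 e2 where e: "e1 > 0" "e2 > 0"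
    "\<And>u. u \<in> {0..1} \<Longrightarrow> dist u b < e1 \<Longrightarrow> dist (f u) (f b) < d"
    "\<And>u. u \<in> {0..1} \<Longrightarrow> dist u b < e2 \<Longrightarrow> dist (g u) (g b) < d" by blast
  define M where "M = \<bar>t\<bar> * L"
  have M: "M \<ge> 0" using dL(2) by (simp add: M_def)
  \<comment> \<open>The first bound keeps both curves in the Lipschitz ball, the second makes the
    interval short enough for \<open>ode_unique_short\<close>; M + 1 avoids division by
    zero.\<close>
  define \<delta> where "\<delta> = min (min e1 e2 / 2) (1 / (2 * (M + 1)))"
  have \<delta>: "\<delta> > 0" "\<delta> < e1" "\<delta> < e2" "M * \<delta> \<le> 1 / 2"
  proof -
    show "\<delta> > 0" "\<delta> < e1" "\<delta> < e2" using e(1,2) M by (auto simp: \<delta>_def)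
    have "M * \<delta> \<le> M * (1 / (2 * (M + 1)))" using M by (intro mult_left_mono) (auto simp: \<delta>_def)
    also have "\<dots> \<le> 1 / 2" using M by (simp add: field_simps)
    finally show "M * \<delta> \<le> 1 / 2" .
  qed
  define b' where "b' = min 1 (b + \<delta>)"
  have b': "b \<le> b'" "b' \<in> {0..1}" "b' - b \<le> \<delta>" using b01 \<delta> by (auto simp: b'_def)
  have near: "f u \<in> ball (f b) d" "g u \<in> ball (f b) d" if "u \<in> {b..b'}" for u
    using e(3)[of u] e(4)[of u] that b' \<delta> b01 at_b by (auto simp: dist_commute dist_real_def)
  have gU: "g ` {0..b'} \<subseteq> U"
  proof
    fix w assume "w \<in> g ` {0..b'}"
    then obtain u where u: "u \<in> {0..b'}" "w = g u" by blast
    show "w \<in> U"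
    proof (cases "u < b")
      case True
      then show ?thesis using below[of u] u f[of u] b01 by auto
    next
      case False
      then show ?thesis using near(2)[of u] u dL(3) by auto
    qed
  qed
  have agree: "f u = g u" if "u \<in> {b..b'}" for u
  proof (rule ode_unique_short[where V = "\<lambda>x. t *\<^sub>R V x" and S = "ball (f b) d" and L = M
        and a = b and b = b' and f = f and g = g])
    show "b \<le> b'" "0 \<le> M" "f b = g b" "u \<in> {b..b'}" by fact+
    show "M * (b' - b) \<le> 1 / 2" using b'(3) \<delta>(4) M mult_left_mono order_trans by blast
    show "norm (t *\<^sub>R V x - t *\<^sub>R V y) \<le> M * norm (x - y)" if "x \<in> ball (f b) d" "y \<in> ball (f b) d" for x y
    proof -
      have "norm (t *\<^sub>R V x - t *\<^sub>R V y) = \<bar>t\<bar> * norm (V x - V y)"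
        by (simp flip: scaleR_diff_right)
      also have "\<dots> \<le> \<bar>t\<bar> * (L * norm (x - y))" using dL(4)[OF that] by (intro mult_left_mono) auto
      finally show ?thesis by (simp add: M_def mult.assoc)
    qed
    have sub: "{b..b'} \<subseteq> {0..1}" using b01 b' by auto
    show "f s \<in> ball (f b) d \<and> (f has_vector_derivative t *\<^sub>R V (f s)) (at s within {b..b'})" if "s \<in> {b..b'}" for s
      using near[OF that] f[of s] sub that has_vector_derivative_within_subset[OF _ sub] by blast
    show "g s \<in> ball (f b) d \<and> (g has_vector_derivative t *\<^sub>R V (g s)) (at s within {b..b'})" if "s \<in> {b..b'}" for s
      using near[OF that] gK[OF b'(2) gU, of s] that b01 has_vector_derivative_within_subset[OF _ sub] by auto
  qed
  have "a \<ge> b'" if "a \<in> A" for a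
  proof (rule ccontr)
    assume "\<not> b' \<le> a"
    moreover have "b \<le> a" using that A(2) by (simp add: b_def cInf_lower)
    ultimately have "f a = g a" using agree by auto
    then show False using that by (simp add: A_def)
  qed
  \<comment> \<open>Agreement beyond the infimum b is possible only if b = 1; then A is reduced to
    the point 1, where the curves agree by continuity.\<close>
  then have "b \<ge> b'" unfolding b_def using A(1) by (intro cInf_greatest) auto
  then have "b = 1" using \<delta>(1) b01 by (auto simp: b'_def min_def split: if_splits)
  have "a = 1" if "a \<in> A" for a
  proof -
    have "b \<le> a" using that A(2) by (simp add: b_def cInf_lower)
    then show ?thesis using that \<open>b = 1\<close> by (auto simp: A_def)
  qed
  then have "1 \<in> A" using A(1) by blast
  then show False using at_b \<open>b = 1\<close> by (simp add: A_def)
qed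

text \<open>The integral of exp(c u) for u from 0 to s, that is, the solution of a' = c a + 1 with
  a(0) = 0.\<close>

definition flow_shift :: "real \<Rightarrow> real \<Rightarrow> real" where
  "flow_shift c s = (if c = 0 then s else (exp (c * s) - 1) / c)"

definition flow :: "real \<Rightarrow> real^3 \<Rightarrow> real \<Rightarrow> real \<Rightarrow> pt \<Rightarrow> pt" where
  "flow c v r s = similarity (exp (c * s)) (flow_shift c s *\<^sub>R v) (exp (r * s))"

lemma flow_shift_deriv:
  "((\<lambda>s. flow_shift c (t * s)) has_real_derivative t * exp (c * (t * s))) (at s within S)"
proof (cases "c = 0")
  case True
  then show ?thesis by (auto simp: flow_shift_def intro!: derivative_eq_intros)
next
  case False
  then show ?thesis unfolding flow_shift_def
    by (auto intro!: derivative_eq_intros)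
qed

lemma flow_deriv:
  "((\<lambda>s. flow c v r (t * s) z) has_vector_derivative t *\<^sub>R generator_field c v r (flow c v r (t * s) z))
    (at s within S)"
proof -
  obtain x l h where z: "z = (x, l, h)" by (cases z)
  have e: "((\<lambda>s. exp (k * (t * s))) has_vector_derivative (t * k * exp (k * (t * s)))) (at s within S)" for k
    unfolding has_real_derivative_iff_has_vector_derivative[symmetric] by (auto intro!: derivative_eq_intros)
  have q: "((\<lambda>s. flow_shift c (t * s)) has_vector_derivative (t * exp (c * (t * s)))) (at s within S)"
    using flow_shift_deriv has_real_derivative_iff_has_vector_derivative by blast
  have sc: "((\<lambda>s. f s *\<^sub>R w) has_vector_derivative d *\<^sub>R w) (at s within S)"
    if "(f has_vector_derivative d) (at s within S)" for f d and w :: "'b::real_normed_vector"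
    using that has_vector_derivative_scaleR[of f d s S "\<lambda>_. w" 0]
    by (simp add: has_real_derivative_iff_has_vector_derivative)
  \<comment> \<open>This identity covers c = 0 as well and turns the velocity of the x-part into c x
    + v.\<close>
  have one: "exp (c * u) = c * flow_shift c u + 1" for u by (simp add: flow_shift_def)
  have vv: "(t * exp (c * (t * s))) *\<^sub>R v = (t * c * flow_shift c (t * s)) *\<^sub>R v + t *\<^sub>R v"
    unfolding one by (simp add: algebra_simps)
  have "((\<lambda>s. (exp (c * (t * s)) *\<^sub>R x + flow_shift c (t * s) *\<^sub>R v, exp (r * (t * s)) *\<^sub>R l, exp ((- c) * (t * s)) *\<^sub>R h))
    has_vector_derivative ((t * c * exp (c * (t * s))) *\<^sub>R x + (t * exp (c * (t * s))) *\<^sub>R v,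
      (t * r * exp (r * (t * s))) *\<^sub>R l, (t * (- c) * exp ((- c) * (t * s))) *\<^sub>R h)) (at s within S)"
    by (intro has_vector_derivative_Pair has_vector_derivative_add sc e q)
  moreover have "(\<lambda>s. flow c v r (t * s) z) = (\<lambda>s. (exp (c * (t * s)) *\<^sub>R x + flow_shift c (t * s) *\<^sub>R v, exp (r * (t * s)) *\<^sub>R l, exp ((- c) * (t * s)) *\<^sub>R h))"
    by (auto simp: z flow_def similarity_def exp_minus)
  moreover have "t *\<^sub>R generator_field c v r (flow c v r (t * s) z)
    = ((t * c * exp (c * (t * s))) *\<^sub>R x + (t * exp (c * (t * s))) *\<^sub>R v,
      (t * r * exp (r * (t * s))) *\<^sub>R l, (t * (- c) * exp ((- c) * (t * s))) *\<^sub>R h)"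
    unfolding vv
    by (simp add: z flow_def similarity_def generator_field_def exp_minus algebra_simps)
  ultimately show ?thesis by (simp only:)
qed

lemma flow_cone_points: "z \<in> cone_points \<Longrightarrow> flow c v r s z \<in> cone_points"
proof -
  assume "z \<in> cone_points"
  moreover have "(k * a)\<^sup>2 - (k * b)\<^sup>2 + (k * d)\<^sup>2 = k\<^sup>2 * (a\<^sup>2 - b\<^sup>2 + d\<^sup>2)" for k a b d :: real
    by (simp add: algebra_simps)
  ultimately show ?thesis
    by (auto simp: flow_def similarity_def cone_points_def variable_space_def)
qed

text \<open>The cone is invariant under translations in x, so a small step in x_1 stays on it and
  detects c. Then v, and r because l is nonzero, are read off at w.\<close>

lemma generator_field_eq_locally:
  assumes w: "w \<in> cone_points" and e: "e > 0"
    and eq: "\<And>z. z \<in> ball w e \<Longrightarrow> z \<in> cone_points \<Longrightarrow> generator_field c v r z = generator_field c' v' r' z"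
  shows "c = c' \<and> v = v' \<and> r = r'"
proof -
  obtain x l h where ww: "w = (x, l, h)" by (cases w)
  let ?y = "(x + (e/2) *\<^sub>R axis 1 1, l, h)"
  have "?y \<in> cone_points" using w by (simp add: ww cone_points_def variable_space_def)
  moreover have "?y \<in> ball w e" using e by (simp add: ww dist_norm norm_Pair)
  ultimately have 1: "c *\<^sub>R (x + (e/2) *\<^sub>R axis 1 1) + v = c' *\<^sub>R (x + (e/2) *\<^sub>R axis 1 1) + v'"
    using eq[of ?y] by (simp add: generator_field_def)
  have 2: "c *\<^sub>R x + v = c' *\<^sub>R x + v'" "r *\<^sub>R l = r' *\<^sub>R l"
    using eq[of w] w e by (simp_all add: generator_field_def ww)
  have "(k * (e/2)) *\<^sub>R axis 1 1 = (k *\<^sub>R (x + (e/2) *\<^sub>R axis 1 1) + u) - (k *\<^sub>R x + u)" for k u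
    by (simp add: algebra_simps)
  from this[of c v] this[of c' v'] have "(c * (e/2)) *\<^sub>R axis 1 1 = (c' * (e/2)) *\<^sub>R (axis 1 1 :: real^3)"
    unfolding 1 2(1) by metis
  then have "c = c'" using e by (simp add: axis_eq_0_iff)
  moreover have "l \<noteq> 0" using w by (auto simp: ww cone_points_def variable_space_def)
  ultimately show ?thesis using 2 by auto
qed

section \<open>From local to connected pieces of the cone\<close>

context lame_generator
begin

text \<open>Parameters and radii are chosen point by point. At a point b of K inside the ball of a
  both forms hold near b on the cone, so the parameters coincide; being locally constant on a
  connected set, they are constant.\<close>

lemma generator_form_connected:
  assumes K: "connected K" "K \<subseteq> U \<inter> cone_points"
  obtains c v r where "\<And>z. z \<in> K \<Longrightarrow> V z = generator_field c v r z"
proof -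
  have "\<forall>a\<in>K. \<exists>p e. e > 0 \<and>
      (\<forall>z\<in>ball a e \<inter> cone_points. V z = generator_field (fst p) (fst (snd p)) (snd (snd p)) z)"
  proof
    fix a assume "a \<in> K"
    then have a: "a \<in> U" "a \<in> cone_points" using K(2) by auto
    obtain e c v r where "e > 0"
      "\<And>z. z \<in> ball a e \<Longrightarrow> z \<in> cone_points \<Longrightarrow> V z = generator_field c v r z"
      by (rule generator_local_form[OF a]) blast
    then show "\<exists>p e. e > 0 \<and>
      (\<forall>z\<in>ball a e \<inter> cone_points. V z = generator_field (fst p) (fst (snd p)) (snd (snd p)) z)"
      by (intro exI[of _ "(c, v, r)"] exI[of _ e]) auto
  qed
  from bchoice[OF this] obtain p where "\<forall>a\<in>K. \<exists>e. e > 0 \<and>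
      (\<forall>z\<in>ball a e \<inter> cone_points. V z = generator_field (fst (p a)) (fst (snd (p a))) (snd (snd (p a))) z)"
    by blast
  from bchoice[OF this] obtain e where pe: "\<And>a. a \<in> K \<Longrightarrow> e a > 0"
    "\<And>a z. a \<in> K \<Longrightarrow> z \<in> ball a (e a) \<Longrightarrow> z \<in> cone_points \<Longrightarrow>
      V z = generator_field (fst (p a)) (fst (snd (p a))) (snd (snd (p a))) z"
    by blast
  have loc: "p a = p b" if a: "a \<in> K" and b: "b \<in> K" and ab: "b \<in> ball a (e a)" for a b
  proof -
    obtain d where d: "d > 0" "ball b d \<subseteq> ball a (e a) \<inter> ball b (e b)"
    proof -
      have "open (ball a (e a) \<inter> ball b (e b))" "b \<in> ball a (e a) \<inter> ball b (e b)"
        using ab pe(1)[OF b] by auto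
      then show thesis using that openE by metis
    qed
    have "fst (p a) = fst (p b) \<and> fst (snd (p a)) = fst (snd (p b)) \<and> snd (snd (p a)) = snd (snd (p b))"
    proof (rule generator_field_eq_locally[OF _ d(1)])
      show "b \<in> cone_points" using b K(2) by blast
      show "generator_field (fst (p a)) (fst (snd (p a))) (snd (snd (p a))) z
        = generator_field (fst (p b)) (fst (snd (p b))) (snd (snd (p b))) z" if "z \<in> ball b d" "z \<in> cone_points" for z
      proof -
        have "z \<in> ball a (e a)" "z \<in> ball b (e b)" using that(1) d(2) by blast+
        from pe(2)[OF a this(1) that(2)] pe(2)[OF b this(2) that(2)] show ?thesis by (rule trans[OF sym])
      qed
    qed
    then show ?thesis by (simp add: prod_eq_iff)
  qed
  have const: "p a = p b" if "a \<in> K" "b \<in> K" for a b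
  proof (rule connected_local_const[OF K(1) that], intro ballI)
    fix a assume a: "a \<in> K"
    show "\<forall>\<^sub>F b in at a within K. p a = p b"
      unfolding eventually_at
    proof (intro exI[of _ "e a"] conjI ballI impI)
      show "0 < e a" using pe(1)[OF a] .
      show "p a = p b" if "b \<in> K" "b \<noteq> a \<and> dist b a < e a" for b
        using loc[OF a that(1)] that(2) by (simp add: dist_commute)
    qed
  qed
  show thesis
  proof (cases "K = {}")
    case False
    then obtain a where a: "a \<in> K" by blast
    have "V z = generator_field (fst (p a)) (fst (snd (p a))) (snd (snd (p a))) z" if "z \<in> K" for z
      using pe(2)[OF that, of z] pe(1)[OF that] that K(2) const[OF a that] by auto
    then show thesis by (rule that)
  qed (use that in blast)
qed

lemma exp_generator:
  assumes C: "C \<subseteq> U \<inter> cone_points" "connected C"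
  shows "\<exists>T\<in>compositions. \<forall>z\<in>C. \<forall>w. exp_field U V t z w \<longrightarrow> w = T z"
proof (cases "C = {}")
  case True
  then show ?thesis using similarity_in_compositions[of 1 1 0] by auto
next
  case False
  then obtain z0 where z0: "z0 \<in> C" by blast
  \<comment> \<open>The integral curves need not stay in C. The whole component gives parameters
    valid along the curves too, and the same for every starting point in C.\<close>
  define K where "K = connected_component_set (U \<inter> cone_points) z0"
  have K: "connected K" "K \<subseteq> U \<inter> cone_points"
    unfolding K_def by (rule connected_connected_component, rule connected_component_subset)
  have CK: "C \<subseteq> K" unfolding K_def using connected_component_maximal[OF z0 C(2,1)] .
  obtain c v r where V: "\<And>z. z \<in> K \<Longrightarrow> V z = generator_field c v r z"
    by (rule generator_form_connected[OF K]) blast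
  show ?thesis
  proof (intro bexI ballI allI impI)
    show "flow c v r t \<in> compositions" unfolding flow_def by (rule similarity_in_compositions) auto
    fix z w assume z: "z \<in> C" and "exp_field U V t z w"
    then obtain \<gamma> where \<gamma>: "\<gamma> 0 = z" "\<gamma> t = w" "\<And>s. s \<in> closed_segment 0 t \<Longrightarrow>
        \<gamma> s \<in> U \<and> (\<gamma> has_vector_derivative V (\<gamma> s)) (at s within closed_segment 0 t)"
      by (auto simp: exp_field_def)
    \<comment> \<open>Rescaling time to [0, 1] treats positive and negative t alike, at the price of
      a factor t in front of V.\<close>
    define f where "f = \<gamma> \<circ> (\<lambda>s. t * s)"
    define g where "g s = flow c v r (t * s) z" for s
    have seg: "t * s \<in> closed_segment 0 t" if "s \<in> {0..1}" for s
      using that by (auto simp: in_segment mult.commute)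
    have gd: "(g has_vector_derivative t *\<^sub>R generator_field c v r (g s)) (at s within S)" for s S
      unfolding g_def by (rule flow_deriv)
    have gc: "continuous_on S g" for S
      by (rule continuous_on_vector_derivative) (rule gd)
    have g0: "g 0 = z" by (auto simp: g_def flow_def flow_shift_def similarity_def split_beta)
    have "f 1 = g 1"
    proof (rule ode_continuation[where V = V and U = U and t = t])
      show "smooth_on_open V U" using gen by (simp add: infinitesimal_generator_def)
      show "f s \<in> U \<and> (f has_vector_derivative t *\<^sub>R V (f s)) (at s within {0..1})" if s: "s \<in> {0..1}" for s
      proof
        show "f s \<in> U" using \<gamma>(3)[OF seg[OF s]] by (simp add: f_def)
        have "((\<lambda>s. t * s) has_vector_derivative t) (at s within {0..1})"
          unfolding has_real_derivative_iff_has_vector_derivative[symmetric] by (auto intro!: derivative_eq_intros)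
        moreover have "(\<gamma> has_vector_derivative V (\<gamma> (t * s))) (at (t * s) within (\<lambda>s. t * s) ` {0..1})"
          using \<gamma>(3)[OF seg[OF s]] seg by (blast intro: has_vector_derivative_within_subset)
        ultimately show "(f has_vector_derivative t *\<^sub>R V (f s)) (at s within {0..1})"
          unfolding f_def by (simp add: vector_diff_chain_within)
      qed
      show "(g has_vector_derivative t *\<^sub>R V (g s)) (at s within {0..1})"
        if b: "b \<in> {0..1}" and gU: "g ` {0..b} \<subseteq> U" and s: "s \<in> {0..b}" for b s
      proof -
        \<comment> \<open>The flow preserves the cone, so while it remains in \<open>U\<close> its
          arc is connected within \<open>U \<inter> cone_points\<close> and starts in K; it stays in
          K, where V equals the explicit field.\<close>
        have zc: "z \<in> cone_points" using z C by blast
        have sub: "g ` {0..b} \<subseteq> U \<inter> cone_points"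
          using gU flow_cone_points[OF zc] by (auto simp: g_def)
        have "connected (g ` {0..b})" by (intro connected_continuous_image gc connected_Icc)
        then have "connected (K \<union> g ` {0..b})"
          using K(1) CK z b g0 by (intro connected_Un) (auto intro!: image_eqI[of _ _ 0])
        then have "K \<union> g ` {0..b} \<subseteq> K"
          using K sub z0 CK unfolding K_def by (intro connected_component_maximal) auto
        then have "g s \<in> K" using s by auto
        then show ?thesis using gd V by simp
      qed
    qed (use gc g0 \<gamma>(1) in \<open>auto simp: f_def\<close>)
    then show "w = flow c v r t z" using \<gamma>(2) by (simp add: f_def g_def)
  qed
qed

end

theorem corollary1:
  shows "(\<forall>v. lame_symmetry (translation v)) \<and>
    (\<forall>c. c \<noteq> 0 \<longrightarrow> lame_symmetry (dilation_indep c)) \<and>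
    (\<forall>r. r \<noteq> 0 \<longrightarrow> lame_symmetry (dilation_dep r)) \<and>
    (\<forall>U V C t. infinitesimal_generator U V \<and> C \<subseteq> U \<inter> cone_points \<and> connected C \<longrightarrow>
      (\<exists>T\<in>compositions. \<forall>z\<in>C. \<forall>w. exp_field U V t z w \<longrightarrow> w = T z))"
proof (intro conjI allI impI)
  show "lame_symmetry (translation v)" for v
    unfolding translation_eq_similarity by (rule lame_symmetry_similarity) auto
  show "lame_symmetry (dilation_indep c)" if "c \<noteq> 0" for c
    unfolding dilation_indep_eq_similarity by (rule lame_symmetry_similarity) (use that in auto)
  show "lame_symmetry (dilation_dep r)" if "r \<noteq> 0" for r
    unfolding dilation_dep_eq_similarity by (rule lame_symmetry_similarity) (use that in auto)
  fix U V C t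
  assume a: "infinitesimal_generator U V \<and> C \<subseteq> U \<inter> cone_points \<and> connected C"
  then interpret lame_generator U V by unfold_locales auto
  show "\<exists>T\<in>compositions. \<forall>z\<in>C. \<forall>w. exp_field U V t z w \<longrightarrow> w = T z"
    using a exp_generator by blast
qed

end
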